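(* For every dominant monomial $m\in\widetilde{\mathcal Y}_{q,t}$ (type $G_2$ setting) there is a unique $F(m)\in\mathfrak K$ such that $m$ is the unique dominant monomial of $F(m)$.
   Context: Parameters: $q,t\in\mathbb C^\times$ are not roots of unity, $q^{\mathbb Z}\cap t^{\mathbb Z}=\{1\}$, $\epsilon=e^{i\pi/3}$, and $\mathcal C=q^{\mathbb Z}t^{\mathbb Z}$ (free abelian on $q,t$). For $a=q^lt^m\in\mathcal C$ put $\Pi_q(a)=q^l$, $\Pi_t(a)=\epsilon^lt^m$. The Lie algebra is $G_2$, $I=\{1,2\}$, $r_1=3$, $r_2=1$, $r_1^\vee=1$, $r_2^\vee=3$. Interpolating ring: let $\beta$ be an indeterminate (it stands for a function $\beta(q,t)$ with $\beta(q,1)=1$, $\beta(\epsilon,t)=0$; only these values are used). Put $W_{1,a}=Y_{1,a}$, $W_{2,a}=Y_{2,aq^{-2}}Y_{2,a}Y_{2,aq^2}$, and $\mathcal Y_{q,t}=\mathbb Z[W_{i,a}^{\pm1},\beta Y_{i,a}^{\pm1},\beta]_{i\in I,a\in\mathcal C}\subset\mathbb Z[Y_{i,a}^{\pm1},\beta]_{i\in I,a\in\mathcal C}$. Let $\mathcal Y_q=\mathbb Z[Y_{i,a}^{\pm1}]_{i\in I,a\in q^{\mathbb Z}}$ and $\mathcal Y_t^L=\mathbb Z[Z_{1,a}^{\pm1},Z_{2,a^3}^{\pm1}]_{a\in\epsilon^{\mathbb Z}t^{\mathbb Z}}$. There are surjective ring homomorphisms: $\Pi_q:\mathcal Y_{q,t}\to\mathcal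 Y_q$ (set $t=1$), induced by $\beta\mapsto1$, $Y_{i,a}\mapsto Y_{i,\Pi_q(a)}$; and $\Pi_t:\mathcal Y_{q,t}\to\mathcal Y_t^L$ (set $q=\epsilon$), given by $\beta\mapsto0$, $\beta Y_{i,a}^{\pm1}\mapsto0$, $W_{1,a}\mapsto Z_{1,\Pi_t(a)}$, $W_{2,a}\mapsto Z_{2,-\Pi_t(a)^3}$ (i.e. $Y_{2,b}Y_{2,\epsilon^2b}Y_{2,\epsilon^4b}=Z_{2,-b^3}$). Let $\widetilde{\mathcal Y}_{q,t}=\mathcal Y_{q,t}/(\ker\Pi_q\cap\ker\Pi_t)$; $\Pi_q,\Pi_t$ descend to it. Subalgebras: for $a\in\mathcal C$ put $\widetilde A_{1,a}=Y_{1,a(q^3t)^{-1}}Y_{1,aq^3t}(Y_{2,aq^{-2}}Y_{2,a}Y_{2,aq^2})^{-1}$ and $\widetilde A_{2,a}=Y_{2,a(qt)^{-1}}Y_{2,aqt}Y_{1,a}^{-1}$. In $\widetilde{\mathcal Y}_{q,t}$ let $\mathfrak K_{1,q,t}=\mathbb Z[Y_{1,a}(1+\widetilde A_{1,aq^3t}^{-1}),W_{2,a}^{\pm1},\beta Y_{2,a}^{\pm1},\beta]_{a\in\mathcal C}$ and $\mathfrak K_{2,q,t}=\mathbb Z[Y_{2,a}Y_{2,aq^2}Y_{2,aq^4}(1+\beta\widetilde A_{2,aq^5t}^{-1}+\beta\widetilde A_{2,aq^5t}^{-1}\widetilde A_{2,aq^3t}^{-1}+\widetilde A_{2,aq^5t}^{-1}\widetilde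 A_{2,aq^3t}^{-1}\widetilde A_{2,aqt}^{-1}),\ \beta Y_{2,a}(1+\widetilde A_{2,aqt}^{-1}),\ Y_{1,a}^{\pm1},\ \beta]_{a\in\mathcal C}$, and put $\mathfrak K=\mathfrak K_{1,q,t}\cap\mathfrak K_{2,q,t}$. Monomials: a monomial of $\widetilde{\mathcal Y}_{q,t}$ is an element of the form $(\lambda+\mu\beta)M$ with $\lambda,\mu\in\mathbb Z$ and $M$ a monomial in the $Y_{i,a}^{\pm1}$. It is dominant if it can be written using only $\beta$ and nonnegative powers of the $Y_{i,a}$. A monomial of $\mathcal Y_q$ or $\mathcal Y_t^L$ is dominant if it involves only nonnegative powers of the variables. Since an element of $\widetilde{\mathcal Y}_{q,t}$ is determined by its images under $\Pi_q$ and $\Pi_t$, "$m$ is the unique dominant monomial of $\chi$" means that no dominant monomial occurs in $\Pi_q(\chi)-\Pi_q(m)$ nor in $\Pi_t(\chi)-\Pi_t(m)$. *)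

theory Defs
  imports
    Complex_Main
    "HOL-Library.Poly_Mapping"
    "HOL-Computational_Algebra.Polynomial"
    "HOL-Algebra.QuotRing"
    "HOL-Algebra.Generated_Rings"
    "HOL-Algebra.Algebraic_Closure_Type"
begin

section \<open>Laurent polynomials in the variables \<open>Y\<^sub>i\<^sub>,\<^sub>a\<close> and \<open>\<beta>\<close>\<close>

datatype node = N1 | N2

text \<open>
  A Laurent monomial is its exponent vector, written additively; a Laurent polynomial is an element
  of the group ring of the group of exponent vectors. A power of \<open>\<beta>\<close> is part of the coefficient,
  so that \<open>lmon \<Rightarrow>\<^sub>0 int poly\<close> stands for \<open>\<int>[Y\<^sub>i\<^sub>,\<^sub>a\<^sup>\<plusminus>\<^sup>1, \<beta>]\<close>. The types allow every complex index \<open>a\<close>;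
  the indices are restricted in the carriers below.
\<close>

type_synonym lmon = "(node \<times> complex) \<Rightarrow>\<^sub>0 int"

abbreviation yvar :: "node \<Rightarrow> complex \<Rightarrow> lmon" where
  "yvar i a \<equiv> Poly_Mapping.single (i, a) 1"

definition Ymon :: "lmon \<Rightarrow> (lmon \<Rightarrow>\<^sub>0 'c::comm_ring_1)" where
  "Ymon M = Poly_Mapping.single M 1"

definition beta :: "lmon \<Rightarrow>\<^sub>0 int poly" where
  "beta = Poly_Mapping.single 0 [:0, 1:]"

definition dominant :: "lmon \<Rightarrow> bool" where
  "dominant M \<longleftrightarrow> (\<forall>v. 0 \<le> Poly_Mapping.lookup M v)"

fun wvar :: "complex \<Rightarrow> node \<Rightarrow> complex \<Rightarrow> lmon" where
  "wvar q N1 a = yvar N1 a"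
| "wvar q N2 a = yvar N2 (a / q^2) + yvar N2 a + yvar N2 (a * q^2)"

fun Aexp :: "complex \<Rightarrow> complex \<Rightarrow> node \<Rightarrow> complex \<Rightarrow> lmon" where
  "Aexp q t N1 a = yvar N1 (a / (q^3 * t)) + yvar N1 (a * q^3 * t)
                - (yvar N2 (a / q^2) + yvar N2 a + yvar N2 (a * q^2))"
| "Aexp q t N2 a = yvar N2 (a / (q * t)) + yvar N2 (a * q * t) - yvar N1 a"

definition eps :: complex where
  "eps = exp (\<i> * complex_of_real pi / 3)"

definition powers :: "complex \<Rightarrow> complex set" where
  "powers q = {q powi l | l. True}"

definition qt_lattice :: "complex \<Rightarrow> complex \<Rightarrow> complex set" where
  "qt_lattice q t = {q powi l * t powi m | l m. True}"


section \<open>The interpolating ring and its two specializations\<close>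

definition gen_subring :: "'a::comm_ring_1 set \<Rightarrow> 'a ring" where
  "gen_subring S = ring_of_type_algebra \<lparr>carrier := generate_ring ring_of_type_algebra S\<rparr>"

definition Y_all :: "complex \<Rightarrow> complex \<Rightarrow> (lmon \<Rightarrow>\<^sub>0 int poly) ring" where
  "Y_all q t = gen_subring
     ({Ymon (yvar i a) | i a. a \<in> qt_lattice q t} \<union> {Ymon (- yvar i a) | i a. a \<in> qt_lattice q t} \<union> {beta})"

definition Y_qt :: "complex \<Rightarrow> complex \<Rightarrow> (lmon \<Rightarrow>\<^sub>0 int poly) ring" where
  "Y_qt q t = gen_subring
     ({Ymon (wvar q i a) | i a. a \<in> qt_lattice q t} \<union> {Ymon (- wvar q i a) | i a. a \<in> qt_lattice q t} \<union>
      {beta * Ymon (yvar i a) | i a. a \<in> qt_lattice q t} \<union>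
      {beta * Ymon (- yvar i a) | i a. a \<in> qt_lattice q t} \<union> {beta})"

definition Y_q :: "complex \<Rightarrow> (lmon \<Rightarrow>\<^sub>0 int) ring" where
  "Y_q q = gen_subring
     ({Ymon (yvar i a) | i a. a \<in> powers q} \<union> {Ymon (- yvar i a) | i a. a \<in> powers q})"

text \<open>Here the variable \<open>yvar i a\<close> plays the role of \<open>Z\<^sub>i\<^sub>,\<^sub>a\<close>.\<close>

definition Y_tL :: "complex \<Rightarrow> (lmon \<Rightarrow>\<^sub>0 int) ring" where
  "Y_tL t = gen_subring
     ({Ymon (yvar N1 a) | a. a \<in> qt_lattice eps t} \<union> {Ymon (- yvar N1 a) | a. a \<in> qt_lattice eps t} \<union>
      {Ymon (yvar N2 (a^3)) | a. a \<in> qt_lattice eps t} \<union> {Ymon (- yvar N2 (a^3)) | a. a \<in> qt_lattice eps t})"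

text \<open>
  The specializations are the ring homomorphisms with the prescribed values on generators, for
  \<open>a = q\<^sup>l t\<^sup>m\<close>. Existence and uniqueness are shown below. Outside \<open>Y_all\<close>, respectively
  \<open>Y_qt\<close>, the values are irrelevant.
\<close>

definition is_Pi_q :: "complex \<Rightarrow> complex \<Rightarrow> ((lmon \<Rightarrow>\<^sub>0 int poly) \<Rightarrow> (lmon \<Rightarrow>\<^sub>0 int)) \<Rightarrow> bool" where
  "is_Pi_q q t h \<longleftrightarrow> h \<in> ring_hom (Y_all q t) (Y_q q) \<and> h beta = 1 \<and>
     (\<forall>i l m. h (Ymon (yvar i (q powi l * t powi m))) = Ymon (yvar i (q powi l)))"

definition Pi_q :: "complex \<Rightarrow> complex \<Rightarrow> (lmon \<Rightarrow>\<^sub>0 int poly) \<Rightarrow> (lmon \<Rightarrow>\<^sub>0 int)" where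
  "Pi_q q t = (SOME h. is_Pi_q q t h)"

definition is_Pi_t :: "complex \<Rightarrow> complex \<Rightarrow> ((lmon \<Rightarrow>\<^sub>0 int poly) \<Rightarrow> (lmon \<Rightarrow>\<^sub>0 int)) \<Rightarrow> bool" where
  "is_Pi_t q t h \<longleftrightarrow> h \<in> ring_hom (Y_qt q t) (Y_tL t) \<and> h beta = 0 \<and>
     (\<forall>i. \<forall>a\<in>qt_lattice q t. h (beta * Ymon (yvar i a)) = 0 \<and> h (beta * Ymon (- yvar i a)) = 0) \<and>
     (\<forall>l m. h (Ymon (wvar q N1 (q powi l * t powi m))) = Ymon (yvar N1 (eps powi l * t powi m))) \<and>
     (\<forall>l m. h (Ymon (wvar q N2 (q powi l * t powi m))) = Ymon (yvar N2 (- ((eps powi l * t powi m)^3))))"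

definition Pi_t :: "complex \<Rightarrow> complex \<Rightarrow> (lmon \<Rightarrow>\<^sub>0 int poly) \<Rightarrow> (lmon \<Rightarrow>\<^sub>0 int)" where
  "Pi_t q t = (SOME h. is_Pi_t q t h)"

definition ker_both :: "complex \<Rightarrow> complex \<Rightarrow> (lmon \<Rightarrow>\<^sub>0 int poly) set" where
  "ker_both q t =
     a_kernel (Y_qt q t) (Y_q q) (Pi_q q t) \<inter> a_kernel (Y_qt q t) (Y_tL t) (Pi_t q t)"

definition Y_tilde :: "complex \<Rightarrow> complex \<Rightarrow> (lmon \<Rightarrow>\<^sub>0 int poly) set ring" where
  "Y_tilde q t = Y_qt q t Quot ker_both q t"

definition Pi_q_tilde :: "complex \<Rightarrow> complex \<Rightarrow> (lmon \<Rightarrow>\<^sub>0 int poly) set \<Rightarrow> (lmon \<Rightarrow>\<^sub>0 int)" where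
  "Pi_q_tilde q t x = the_elem (Pi_q q t ` x)"

definition Pi_t_tilde :: "complex \<Rightarrow> complex \<Rightarrow> (lmon \<Rightarrow>\<^sub>0 int poly) set \<Rightarrow> (lmon \<Rightarrow>\<^sub>0 int)" where
  "Pi_t_tilde q t x = the_elem (Pi_t q t ` x)"


section \<open>Subalgebras and dominant monomials\<close>

text \<open>
  In \<open>Y_tilde\<close> one has \<open>\<beta>\<^sup>2 = \<beta>\<close>. An expression such as \<open>\<beta> Y\<^sub>1\<^sub>,\<^sub>a Y\<^sub>1\<^sub>,\<^sub>b Y\<^sub>2\<^sub>,\<^sub>c\<^sup>-\<^sup>1 Y\<^sub>2\<^sub>,\<^sub>d\<^sup>-\<^sup>1\<close> need not lie
  in \<open>Y_qt\<close> literally (only after multiplication by a further power of \<open>\<beta>\<close>), but it denotes an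
  element of \<open>Y_tilde\<close> when read modulo \<open>\<beta>\<^sup>2 - \<beta>\<close>. This is how Laurent polynomials are read as
  elements of \<open>Y_tilde\<close> here: \<open>denoted q t S\<close> is the set of elements of \<open>Y_tilde\<close> denoted by members
  of \<open>S\<close>. Each Laurent polynomial denotes at most one element (lemma \<open>denoted_unique\<close>),
  and every generator below does denote one (lemma \<open>K_gens_denotable\<close>).
\<close>

definition denoted ::
  "complex \<Rightarrow> complex \<Rightarrow> (lmon \<Rightarrow>\<^sub>0 int poly) set \<Rightarrow> (lmon \<Rightarrow>\<^sub>0 int poly) set set" where
  "denoted q t S =
     {a_r_coset (Y_qt q t) (ker_both q t) g | g f.
        g \<in> carrier (Y_qt q t) \<and> f \<in> S \<and> (beta^2 - beta) dvd (g - f)}"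

definition K1_gens :: "complex \<Rightarrow> complex \<Rightarrow> (lmon \<Rightarrow>\<^sub>0 int poly) set" where
  "K1_gens q t =
     {Ymon (yvar N1 a) * (1 + Ymon (- Aexp q t N1 (a * q^3 * t))) | a. a \<in> qt_lattice q t} \<union>
     {Ymon (wvar q N2 a) | a. a \<in> qt_lattice q t} \<union> {Ymon (- wvar q N2 a) | a. a \<in> qt_lattice q t} \<union>
     {beta * Ymon (yvar N2 a) | a. a \<in> qt_lattice q t} \<union>
     {beta * Ymon (- yvar N2 a) | a. a \<in> qt_lattice q t} \<union> {beta}"

definition K2_gens :: "complex \<Rightarrow> complex \<Rightarrow> (lmon \<Rightarrow>\<^sub>0 int poly) set" where
  "K2_gens q t =
     {Ymon (yvar N2 a) * Ymon (yvar N2 (a * q^2)) * Ymon (yvar N2 (a * q^4)) *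
        (1 + beta * Ymon (- Aexp q t N2 (a * q^5 * t))
           + beta * Ymon (- Aexp q t N2 (a * q^5 * t)) * Ymon (- Aexp q t N2 (a * q^3 * t))
           + Ymon (- Aexp q t N2 (a * q^5 * t)) * Ymon (- Aexp q t N2 (a * q^3 * t))
             * Ymon (- Aexp q t N2 (a * q * t))) | a. a \<in> qt_lattice q t} \<union>
     {beta * Ymon (yvar N2 a) * (1 + Ymon (- Aexp q t N2 (a * q * t))) | a. a \<in> qt_lattice q t} \<union>
     {Ymon (yvar N1 a) | a. a \<in> qt_lattice q t} \<union> {Ymon (- yvar N1 a) | a. a \<in> qt_lattice q t} \<union> {beta}"

definition K1 :: "complex \<Rightarrow> complex \<Rightarrow> (lmon \<Rightarrow>\<^sub>0 int poly) set set" where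
  "K1 q t = generate_ring (Y_tilde q t) (denoted q t (K1_gens q t))"

definition K2 :: "complex \<Rightarrow> complex \<Rightarrow> (lmon \<Rightarrow>\<^sub>0 int poly) set set" where
  "K2 q t = generate_ring (Y_tilde q t) (denoted q t (K2_gens q t))"

definition Kfrak :: "complex \<Rightarrow> complex \<Rightarrow> (lmon \<Rightarrow>\<^sub>0 int poly) set set" where
  "Kfrak q t = K1 q t \<inter> K2 q t"

text \<open>
  Distinct \<open>(\<lambda> + \<mu>\<beta>)M\<close> may denote the same element of \<open>Y_tilde\<close>; a monomial of \<open>Y_tilde\<close> is dominant
  if at least one way of writing it has a dominant \<open>M\<close>.
\<close>

definition dominant_monomial :: "complex \<Rightarrow> complex \<Rightarrow> (lmon \<Rightarrow>\<^sub>0 int poly) set \<Rightarrow> bool" where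
  "dominant_monomial q t x \<longleftrightarrow>
     (\<exists>(lam::int) (mu::int) M. Poly_Mapping.keys M \<subseteq> UNIV \<times> qt_lattice q t \<and> dominant M \<and>
        x \<in> denoted q t {(of_int lam + of_int mu * beta) * Ymon M})"

definition unique_dominant_monomial ::
  "complex \<Rightarrow> complex \<Rightarrow> (lmon \<Rightarrow>\<^sub>0 int poly) set \<Rightarrow> (lmon \<Rightarrow>\<^sub>0 int poly) set \<Rightarrow> bool" where
  "unique_dominant_monomial q t m x \<longleftrightarrow>
     (\<forall>M \<in> Poly_Mapping.keys (Pi_q_tilde q t x - Pi_q_tilde q t m). \<not> dominant M) \<and>
     (\<forall>M \<in> Poly_Mapping.keys (Pi_t_tilde q t x - Pi_t_tilde q t m). \<not> dominant M)"

section \<open>Well-definedness\<close>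

text \<open>
  The two specializations exist (\<open>is_Pi_q_Pi_q\<close>, \<open>is_Pi_t_Pi_t\<close>) and are determined on the
  respective rings by the prescribed values (\<open>is_Pi_q_unique\<close>, \<open>is_Pi_t_unique\<close>); every listed
  generator of the two subalgebras denotes exactly one element of \<open>Y_tilde\<close>
  (\<open>K_gens_denotable\<close>, \<open>denoted_unique\<close>).
\<close>

lemma carrier_gen_subring: "carrier (gen_subring S) = generate_ring ring_of_type_algebra S"
  by (simp add: gen_subring_def)

lemma gen_subring_simps [simp]:
  "x \<otimes>\<^bsub>gen_subring S\<^esub> z = x * z" "x \<oplus>\<^bsub>gen_subring S\<^esub> z = x + z"
  "\<one>\<^bsub>gen_subring S\<^esub> = 1" "\<zero>\<^bsub>gen_subring S\<^esub> = 0"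
  by (simp_all add: gen_subring_def ring_of_type_algebra_def)

lemma cring_gen_subring: "cring (gen_subring (S :: 'a::comm_ring_1 set))"
proof -
  interpret R: cring "ring_of_type_algebra :: 'a ring" by (rule cring_from_type_algebra)
  have "S \<subseteq> carrier ring_of_type_algebra" by (simp add: ring_of_type_algebra_def)
  then have "subring (generate_ring ring_of_type_algebra S) ring_of_type_algebra"
    by (rule R.generate_ring_is_subring)
  then have "subcring (generate_ring ring_of_type_algebra S) ring_of_type_algebra"
    by (rule R.subcringI')
  then show ?thesis
    unfolding gen_subring_def by (rule R.subcring_iff[THEN iffD1, rotated])
      (simp add: ring_of_type_algebra_def)
qed

lemma a_inv_type: "\<ominus>\<^bsub>ring_of_type_algebra\<^esub> (x::'a::comm_ring_1) = - x"
proof -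
  interpret R: cring "ring_of_type_algebra :: 'a ring" by (rule cring_from_type_algebra)
  show ?thesis
    by (rule R.minus_equality) (simp_all add: ring_of_type_algebra_def)
qed

lemma gen_induct [consumes 1, case_names one incl minus add mult]:
  fixes x :: "'a::comm_ring_1"
  assumes "x \<in> carrier (gen_subring S)"
    and "P 1" and "\<And>x. x \<in> S \<Longrightarrow> P x"
    and "\<And>x. x \<in> carrier (gen_subring S) \<Longrightarrow> P x \<Longrightarrow> P (- x)"
    and "\<And>x z. x \<in> carrier (gen_subring S) \<Longrightarrow> z \<in> carrier (gen_subring S) \<Longrightarrow> P x \<Longrightarrow> P z \<Longrightarrow> P (x + z)"
    and "\<And>x z. x \<in> carrier (gen_subring S) \<Longrightarrow> z \<in> carrier (gen_subring S) \<Longrightarrow> P x \<Longrightarrow> P z \<Longrightarrow> P (x * z)"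
  shows "P x"
proof -
  have "x \<in> generate_ring ring_of_type_algebra S" using assms(1) by (simp add: carrier_gen_subring)
  then show ?thesis
  proof (induction rule: generate_ring.induct)
    case one then show ?case using assms(2) by (simp add: ring_of_type_algebra_def)
  next
    case (incl h) then show ?case using assms(3) by simp
  next
    case (a_inv h) then show ?case using assms(4) by (simp add: a_inv_type carrier_gen_subring)
  next
    case (eng_add h1 h2) then show ?case using assms(5) by (simp add: carrier_gen_subring ring_of_type_algebra_def)
  next
    case (eng_mult h1 h2) then show ?case using assms(6) by (simp add: ring_of_type_algebra_def carrier_gen_subring)
  qed
qed

lemma gen_closed:
  fixes x z :: "'a::comm_ring_1"
  shows "1 \<in> carrier (gen_subring (S::'a set))" "0 \<in> carrier (gen_subring S)"
    and "x \<in> S \<Longrightarrow> x \<in> carrier (gen_subring S)"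
    and "x \<in> carrier (gen_subring S) \<Longrightarrow> - x \<in> carrier (gen_subring S)"
    and "x \<in> carrier (gen_subring S) \<Longrightarrow> z \<in> carrier (gen_subring S) \<Longrightarrow> x + z \<in> carrier (gen_subring S)"
    and "x \<in> carrier (gen_subring S) \<Longrightarrow> z \<in> carrier (gen_subring S) \<Longrightarrow> x - z \<in> carrier (gen_subring S)"
    and "x \<in> carrier (gen_subring S) \<Longrightarrow> z \<in> carrier (gen_subring S) \<Longrightarrow> x * z \<in> carrier (gen_subring S)"
proof -
  note g = generate_ring.intros[where R = "ring_of_type_algebra :: 'a ring" and H = S]
  note r = ring_of_type_algebra_def
  show 1: "1 \<in> carrier (gen_subring S)" using g(1) by (simp add: r carrier_gen_subring)
  show m: "x \<in> carrier (gen_subring S) \<Longrightarrow> - x \<in> carrier (gen_subring S)" for x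
    using g(3) by (simp add: a_inv_type carrier_gen_subring)
  show a: "x \<in> carrier (gen_subring S) \<Longrightarrow> z \<in> carrier (gen_subring S) \<Longrightarrow> x + z \<in> carrier (gen_subring S)" for x z
    using g(4) by (simp add: r carrier_gen_subring)
  show "x \<in> S \<Longrightarrow> x \<in> carrier (gen_subring S)" using g(2) by (simp add: carrier_gen_subring)
  show "0 \<in> carrier (gen_subring S)" using a[OF 1 m[OF 1]] by simp
  show "x \<in> carrier (gen_subring S) \<Longrightarrow> z \<in> carrier (gen_subring S) \<Longrightarrow> x - z \<in> carrier (gen_subring S)"
    using a[OF _ m, of x z] by simp
  show "x \<in> carrier (gen_subring S) \<Longrightarrow> z \<in> carrier (gen_subring S) \<Longrightarrow> x * z \<in> carrier (gen_subring S)"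
    using g(5) by (simp add: r carrier_gen_subring)
qed

lemma Ymon_simps: "Ymon 0 = 1" "Ymon M * Ymon N = Ymon (M + N)"
  by (simp_all add: Ymon_def mult_single)

text \<open>Homomorphisms of Laurent polynomial rings given by substitution.\<close>

definition subst_hom :: "(lmon \<Rightarrow> lmon) \<Rightarrow> (int poly \<Rightarrow> int) \<Rightarrow> (lmon \<Rightarrow>\<^sub>0 int poly) \<Rightarrow> (lmon \<Rightarrow>\<^sub>0 int)" where
  "subst_hom \<phi> c f = (\<Sum>M\<in>Poly_Mapping.keys f. Poly_Mapping.single (\<phi> M) (c (Poly_Mapping.lookup f M)))"

lemma sum_singles: "f = (\<Sum>M\<in>Poly_Mapping.keys f. Poly_Mapping.single M (Poly_Mapping.lookup f M))"
  by (rule poly_mapping_eqI)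
     (auto simp: lookup_sum lookup_single when_def in_keys_iff)

context
  fixes \<phi> :: "lmon \<Rightarrow> lmon" and c :: "int poly \<Rightarrow> int"
  assumes phi: "\<phi> 0 = 0" "\<And>M N. \<phi> (M + N) = \<phi> M + \<phi> N"
    and c: "c 0 = 0" "c 1 = 1" "\<And>x z. c (x + z) = c x + c z" "\<And>x z. c (x * z) = c x * c z"
begin

lemma subst_hom_single: "subst_hom \<phi> c (Poly_Mapping.single M a) = Poly_Mapping.single (\<phi> M) (c a)"
  by (cases "a = 0") (simp_all add: subst_hom_def c)

lemma subst_hom_superset:
  assumes "finite S" "Poly_Mapping.keys f \<subseteq> S"
  shows "subst_hom \<phi> c f = (\<Sum>M\<in>S. Poly_Mapping.single (\<phi> M) (c (Poly_Mapping.lookup f M)))"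
  unfolding subst_hom_def using assms
  by (intro sum.mono_neutral_left) (auto simp: in_keys_iff c)

lemma subst_hom_add: "subst_hom \<phi> c (f + g) = subst_hom \<phi> c f + subst_hom \<phi> c g"
  using subst_hom_superset[of "Poly_Mapping.keys f \<union> Poly_Mapping.keys g"] Poly_Mapping.keys_add[of f g]
  by (simp add: lookup_add c single_add sum.distrib)

lemma subst_hom_0: "subst_hom \<phi> c 0 = 0" by (simp add: subst_hom_def)

lemma subst_hom_sum: "subst_hom \<phi> c (\<Sum>i\<in>I. g i) = (\<Sum>i\<in>I. subst_hom \<phi> c (g i))"
  by (induction I rule: infinite_finite_induct) (simp_all add: subst_hom_0 subst_hom_add)

lemma subst_hom_mult: "subst_hom \<phi> c (f * g) = subst_hom \<phi> c f * subst_hom \<phi> c g"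
proof -
  have "f * g = (\<Sum>M\<in>Poly_Mapping.keys f. \<Sum>N\<in>Poly_Mapping.keys g.
      Poly_Mapping.single (M + N) (Poly_Mapping.lookup f M * Poly_Mapping.lookup g N))"
    by (subst sum_singles[of f], subst sum_singles[of g]) (simp add: sum_product mult_single)
  then have "subst_hom \<phi> c (f * g) = (\<Sum>M\<in>Poly_Mapping.keys f. \<Sum>N\<in>Poly_Mapping.keys g.
      Poly_Mapping.single (\<phi> M + \<phi> N) (c (Poly_Mapping.lookup f M) * c (Poly_Mapping.lookup g N)))"
    by (simp add: subst_hom_sum subst_hom_single phi c)
  then show ?thesis by (simp add: subst_hom_def sum_product mult_single)
qed

lemma subst_hom_1: "subst_hom \<phi> c 1 = 1"
  using subst_hom_single[of 0 1] by (simp add: phi c)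

lemma subst_hom_uminus: "subst_hom \<phi> c (- f) = - subst_hom \<phi> c f"
  using subst_hom_add[of f "- f"] by (simp add: subst_hom_0 eq_neg_iff_add_eq_0 add.commute)

lemma subst_hom_mon: "subst_hom \<phi> c (Ymon M) = Ymon (\<phi> M)"
  by (simp add: Ymon_def subst_hom_single c)

lemma subst_hom_beta: "subst_hom \<phi> c beta = of_int (c [:0, 1:])"
proof -
  have "Poly_Mapping.single 0 (of_int k) = (of_int k :: lmon \<Rightarrow>\<^sub>0 int)" for k :: int
    by (rule single_of_int)
  from this[of "c [:0, 1:]"] show ?thesis by (simp add: beta_def subst_hom_single phi)
qed

lemma subst_hom_ring_hom:
  assumes "\<And>x. x \<in> S \<Longrightarrow> subst_hom \<phi> c x \<in> carrier (gen_subring T)"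
  shows "subst_hom \<phi> c \<in> ring_hom (gen_subring S) (gen_subring T)"
proof (rule ring_hom_memI)
  fix x assume "x \<in> carrier (gen_subring S)"
  then show "subst_hom \<phi> c x \<in> carrier (gen_subring T)"
    by (induction rule: gen_induct)
       (auto simp only: assms subst_hom_1 subst_hom_uminus subst_hom_add subst_hom_mult intro: gen_closed)
qed (simp_all add: subst_hom_add subst_hom_mult subst_hom_1)

end

lemma gen_hom_unique:
  fixes h k :: "'a::comm_ring_1 \<Rightarrow> 'b::comm_ring_1"
  assumes h: "h \<in> ring_hom (gen_subring S) (gen_subring T)"
    and k: "k \<in> ring_hom (gen_subring S) (gen_subring T)"
    and e: "\<And>x. x \<in> S \<Longrightarrow> h x = k x" and x: "x \<in> carrier (gen_subring S)"
  shows "h x = k x"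
proof -
  have um: "f (- x) = - f x" if "f \<in> ring_hom (gen_subring S) (gen_subring T)" "x \<in> carrier (gen_subring S)"
    for f :: "'a \<Rightarrow> 'b" and x
  proof -
    have "f 0 + f 0 = f 0"
      using ring_hom_add[OF that(1) gen_closed(2) gen_closed(2)] by simp
    then have "f 0 = 0" by simp
    moreover have "f (x + - x) = f x + f (- x)"
      using ring_hom_add[OF that(1) that(2) gen_closed(4)[OF that(2)]] by (simp del: add.right_inverse)
    ultimately show ?thesis by (simp add: eq_neg_iff_add_eq_0 add.commute)
  qed
  show ?thesis
    using x
  proof (induction rule: gen_induct)
    case one then show ?case using ring_hom_one[OF h] ring_hom_one[OF k] by simp
  next
    case (add x z) then show ?case using ring_hom_add[OF h] ring_hom_add[OF k] by simp
  next
    case (mult x z) then show ?case using ring_hom_mult[OF h] ring_hom_mult[OF k] by simp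
  qed (simp_all add: e um[OF h] um[OF k])
qed

lemma lattice_free:
  fixes q t :: complex
  assumes "q \<noteq> 0" "t \<noteq> 0" "\<forall>n>0. q ^ n \<noteq> 1" "\<forall>n>0. t ^ n \<noteq> 1" "powers q \<inter> powers t = {1}"
    and "q powi l * t powi m = q powi l' * t powi m'"
  shows "l = l' \<and> m = m'"
proof -
  have no: "k = 0" if "(x::complex) \<noteq> 0" "\<forall>n>0. x ^ n \<noteq> 1" "x powi k = 1" for x k
  proof (rule ccontr)
    assume "k \<noteq> 0"
    then have "x ^ nat \<bar>k\<bar> = 1" using that(3)
      by (auto simp: power_int_def power_inverse split: if_splits)
    then show False using that(2) \<open>k \<noteq> 0\<close> by auto
  qed
  have "q powi (l - l') = t powi (m' - m)"
    using assms by (simp add: power_int_diff field_simps)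
  moreover have "q powi (l - l') \<in> powers q" "t powi (m' - m) \<in> powers t"
    by (auto simp: powers_def)
  ultimately have "q powi (l - l') = 1 \<and> t powi (m' - m) = 1" using assms(5) by auto
  then show ?thesis using no[of q "l - l'"] no[of t "m' - m"] assms by auto
qed


context
  fixes q t :: complex
  assumes nz: "q \<noteq> 0" "t \<noteq> 0"
    and nru: "\<forall>n>0. q ^ n \<noteq> 1" "\<forall>n>0. t ^ n \<noteq> 1" "powers q \<inter> powers t = {1}"
begin

definition q_exp :: "complex \<Rightarrow> int" where
  "q_exp a = fst (SOME p. a = q powi fst p * t powi snd p)"

definition t_exp :: "complex \<Rightarrow> int" where
  "t_exp a = snd (SOME p. a = q powi fst p * t powi snd p)"

lemma exps [simp]: "q_exp (q powi l * t powi m) = l" "t_exp (q powi l * t powi m) = m"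
proof -
  define p where "p = (SOME p. q powi l * t powi m = q powi fst p * t powi snd p)"
  have "q powi l * t powi m = q powi fst p * t powi snd p"
    unfolding p_def by (rule someI[of _ "(l, m)"]) simp
  then have "fst p = l" "snd p = m" using lattice_free[OF nz nru] by blast+
  then show "q_exp (q powi l * t powi m) = l" "t_exp (q powi l * t powi m) = m"
    by (simp_all add: q_exp_def t_exp_def p_def)
qed

definition phi_q :: "lmon \<Rightarrow> lmon" where
  "phi_q = frag_extend (\<lambda>(i, a). yvar i (q powi q_exp a))"

text \<open>
  On exponents, exactly one of the three factors of \<open>W\<^sub>2\<^sub>,\<^sub>a\<close> has a \<open>q\<close>-exponent divisible by 3; this
  factor is sent to \<open>Z\<^sub>2\<close>, the other two to 1.
\<close>

definition phi_t :: "lmon \<Rightarrow> lmon" where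
  "phi_t = frag_extend (\<lambda>(i, a). case i of
     N1 \<Rightarrow> yvar N1 (eps powi q_exp a * t powi t_exp a)
   | N2 \<Rightarrow> (if 3 dvd q_exp a then yvar N2 (- ((eps powi q_exp a * t powi t_exp a)^3)) else 0))"

lemma phi_add: "phi_q 0 = 0" "phi_q (M + N) = phi_q M + phi_q N" "phi_q (- M) = - phi_q M"
  "phi_t 0 = 0" "phi_t (M + N) = phi_t M + phi_t N" "phi_t (- M) = - phi_t M"
  by (simp_all add: phi_q_def phi_t_def frag_extend_add frag_extend_minus)

lemma phi_q_yvar: "phi_q (yvar i (q powi l * t powi m)) = yvar i (q powi l)"
  by (simp add: phi_q_def)

lemma Y_q_mem:
  "Ymon (yvar i (q powi l)) \<in> carrier (Y_q q)" "Ymon (- yvar i (q powi l)) \<in> carrier (Y_q q)"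
  unfolding Y_q_def by (rule gen_closed(3), use powers_def in blast)+

lemma Y_tL_mem:
  assumes "a \<in> qt_lattice eps t"
  shows "Ymon (yvar N1 a) \<in> carrier (Y_tL t)" "Ymon (- yvar N1 a) \<in> carrier (Y_tL t)"
    "Ymon (yvar N2 (a^3)) \<in> carrier (Y_tL t)" "Ymon (- yvar N2 (a^3)) \<in> carrier (Y_tL t)"
  unfolding Y_tL_def by (rule gen_closed(3), use assms in blast)+

lemma Y_all_mem:
  assumes "a \<in> qt_lattice q t"
  shows "Ymon (yvar i a) \<in> carrier (Y_all q t)" "Ymon (- yvar i a) \<in> carrier (Y_all q t)"
    "beta \<in> carrier (Y_all q t)"
  unfolding Y_all_def by (rule gen_closed(3), use assms in blast)+

lemma Y_qt_mem:
  assumes "a \<in> qt_lattice q t"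
  shows "Ymon (wvar q i a) \<in> carrier (Y_qt q t)" "Ymon (- wvar q i a) \<in> carrier (Y_qt q t)"
    "beta * Ymon (yvar i a) \<in> carrier (Y_qt q t)" "beta * Ymon (- yvar i a) \<in> carrier (Y_qt q t)"
    "beta \<in> carrier (Y_qt q t)"
  unfolding Y_qt_def by (rule gen_closed(3), use assms in blast)+

abbreviation "hom_q \<equiv> subst_hom phi_q (\<lambda>p. poly p 1)"
abbreviation "hom_t \<equiv> subst_hom phi_t (\<lambda>p. poly p 0)"

lemmas hom_q_rules =
  subst_hom_add[of phi_q "\<lambda>p. poly p 1", OF phi_add(1,2), simplified]
  subst_hom_mult[of phi_q "\<lambda>p. poly p 1", OF phi_add(1,2), simplified]
  subst_hom_uminus[of phi_q "\<lambda>p. poly p 1", OF phi_add(1,2), simplified]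
  subst_hom_1[of phi_q "\<lambda>p. poly p 1", OF phi_add(1,2), simplified]
  subst_hom_mon[of phi_q "\<lambda>p. poly p 1", OF phi_add(1,2), simplified]
  subst_hom_beta[of phi_q "\<lambda>p. poly p 1", OF phi_add(1,2), simplified]

lemmas hom_t_rules =
  subst_hom_add[of phi_t "\<lambda>p. poly p 0", OF phi_add(4,5), simplified]
  subst_hom_mult[of phi_t "\<lambda>p. poly p 0", OF phi_add(4,5), simplified]
  subst_hom_uminus[of phi_t "\<lambda>p. poly p 0", OF phi_add(4,5), simplified]
  subst_hom_1[of phi_t "\<lambda>p. poly p 0", OF phi_add(4,5), simplified]
  subst_hom_mon[of phi_t "\<lambda>p. poly p 0", OF phi_add(4,5), simplified]
  subst_hom_beta[of phi_t "\<lambda>p. poly p 0", OF phi_add(4,5), simplified]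

lemma qt_latticeE:
  assumes "a \<in> qt_lattice q t" obtains l m where "a = q powi l * t powi m"
  using assms by (auto simp: qt_lattice_def)

lemma is_Pi_q_hom_q: "is_Pi_q q t hom_q"
proof -
  have "hom_q \<in> ring_hom (Y_all q t) (Y_q q)"
    unfolding Y_all_def Y_q_def
  proof (rule subst_hom_ring_hom, goal_cases)
    case (7 x)
    have one: "1 \<in> carrier (Y_q q)" unfolding Y_q_def by (rule gen_closed)
    show ?case
      using 7 one unfolding Y_q_def[symmetric]
      by (auto elim!: qt_latticeE simp: hom_q_rules phi_q_yvar phi_add Y_q_mem)
  qed (auto simp: phi_add)
  then show ?thesis by (simp add: is_Pi_q_def hom_q_rules phi_q_yvar)
qed

lemma is_Pi_q_Pi_q: "is_Pi_q q t (Pi_q q t)"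
  unfolding Pi_q_def by (rule someI[of "is_Pi_q q t", OF is_Pi_q_hom_q])

lemma is_Pi_q_unique:
  assumes h: "is_Pi_q q t h" and k: "is_Pi_q q t k" and x: "x \<in> carrier (Y_all q t)"
  shows "h x = k x"
proof -
  have inv: "h (Ymon (- yvar i a)) = Ymon (- yvar i (q powi q_exp a))"
    if "a \<in> qt_lattice q t" "is_Pi_q q t h" for h i a
  proof -
    note c = Y_all_mem(1,2)[OF that(1), of i]
    have h: "h \<in> ring_hom (Y_all q t) (Y_q q)" using that by (simp add: is_Pi_q_def)
    have v: "h (Ymon (yvar i a)) = Ymon (yvar i (q powi q_exp a))"
      using that by (auto elim!: qt_latticeE simp: is_Pi_q_def)
    have "h (Ymon (yvar i a)) * h (Ymon (- yvar i a)) = 1"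
      using ring_hom_mult[OF h c] ring_hom_one[OF h] by (simp add: Y_all_def Y_q_def Ymon_simps)
    then have "Ymon (- yvar i (q powi q_exp a)) * Ymon (yvar i (q powi q_exp a)) * h (Ymon (- yvar i a))
        = Ymon (- yvar i (q powi q_exp a))"
      unfolding v by (simp add: mult.assoc)
    then show ?thesis by (simp add: Ymon_simps)
  qed
  show ?thesis
  proof (rule gen_hom_unique[OF h[unfolded is_Pi_q_def Y_all_def Y_q_def, THEN conjunct1]
        k[unfolded is_Pi_q_def Y_all_def Y_q_def, THEN conjunct1] _ x[unfolded Y_all_def]])
    fix x assume "x \<in> {Ymon (yvar i a) | i a. a \<in> qt_lattice q t} \<union>
        {Ymon (- yvar i a) | i a. a \<in> qt_lattice q t} \<union> {beta}"
    then consider i a where "a \<in> qt_lattice q t" "x = Ymon (yvar i a)"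
      | i a where "a \<in> qt_lattice q t" "x = Ymon (- yvar i a)" | "x = beta" by blast
    then show "h x = k x"
    proof cases
      case 1 then show ?thesis using h k by (auto elim!: qt_latticeE simp: is_Pi_q_def)
    next
      case 2 then show ?thesis using inv[OF _ h] inv[OF _ k] by simp
    next
      case 3 then show ?thesis using h k by (simp add: is_Pi_q_def)
    qed
  qed
qed

lemma eps_powers: "eps ^ 3 = - 1" "eps \<noteq> 0"
proof -
  have "eps ^ 3 = exp (of_nat 3 * (\<i> * complex_of_real pi / 3))"
    unfolding eps_def by (rule exp_of_nat_mult[symmetric])
  then show "eps ^ 3 = - 1" by (simp add: exp_pi_i')
  show "eps \<noteq> 0" by (simp add: eps_def)
qed

lemma phi_t_wvar:
  "phi_t (wvar q N1 (q powi l * t powi m)) = yvar N1 (eps powi l * t powi m)"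
  "phi_t (wvar q N2 (q powi l * t powi m)) = yvar N2 (- ((eps powi l * t powi m)^3))"
proof -
  show "phi_t (wvar q N1 (q powi l * t powi m)) = yvar N1 (eps powi l * t powi m)"
    by (simp add: phi_t_def)
  have s: "q powi l * t powi m / q^2 = q powi (l - 2) * t powi m"
    "q powi l * t powi m * q^2 = q powi (l + 2) * t powi m"
    using nz by (simp_all add: power_int_diff power_int_add)
  have e: "(eps powi (l - 2))^3 = (eps powi l)^3" "(eps powi (l + 2))^3 = (eps powi l)^3"
    using eps_powers power_mult[of eps 3 2]
    by (simp_all add: power_int_diff power_int_add power_divide power_mult_distrib flip: power_mult)
  have "(3 dvd l \<and> \<not> 3 dvd l - 2 \<and> \<not> 3 dvd l + 2) \<or> (\<not> 3 dvd l \<and> 3 dvd l - 2 \<and> \<not> 3 dvd l + 2)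
     \<or> (\<not> 3 dvd l \<and> \<not> 3 dvd l - 2 \<and> 3 dvd l + 2)" by presburger
  then show "phi_t (wvar q N2 (q powi l * t powi m)) = yvar N2 (- ((eps powi l * t powi m)^3))"
    by (auto simp: phi_t_def frag_extend_add s power_mult_distrib e)
qed

lemma Z_carrier:
  "Ymon (yvar N2 (- ((eps powi l * t powi m)^3))) \<in> carrier (Y_tL t)"
  "Ymon (- yvar N2 (- ((eps powi l * t powi m)^3))) \<in> carrier (Y_tL t)"
proof -
  have "- ((eps powi l * t powi m)^3) = (eps powi (l + 1) * t powi m)^3"
    using eps_powers by (simp add: power_int_add power_mult_distrib)
  moreover have "eps powi (l + 1) * t powi m \<in> qt_lattice eps t" by (auto simp: qt_lattice_def)
  ultimately show "Ymon (yvar N2 (- ((eps powi l * t powi m)^3))) \<in> carrier (Y_tL t)"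
    "Ymon (- yvar N2 (- ((eps powi l * t powi m)^3))) \<in> carrier (Y_tL t)"
    using Y_tL_mem(3,4) by simp_all
qed

lemma is_Pi_t_hom_t: "is_Pi_t q t hom_t"
proof -
  have w: "hom_t (Ymon (wvar q i a)) \<in> carrier (Y_tL t) \<and> hom_t (Ymon (- wvar q i a)) \<in> carrier (Y_tL t)"
    if a: "a \<in> qt_lattice q t" for i a
  proof -
    obtain l m where a: "a = q powi l * t powi m" using a by (rule qt_latticeE)
    show ?thesis
    proof (cases i)
      case N1
      have "Ymon (yvar N1 (eps powi l * t powi m)) \<in> carrier (Y_tL t)"
        "Ymon (- yvar N1 (eps powi l * t powi m)) \<in> carrier (Y_tL t)"
        using Y_tL_mem(1,2) by (auto simp: qt_lattice_def)
      then show ?thesis using N1 a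
        by (simp only: hom_t_rules phi_add phi_t_wvar simp_thms)
    next
      case N2
      then show ?thesis using a Z_carrier
        by (simp only: hom_t_rules phi_add phi_t_wvar simp_thms)
    qed
  qed
  have "hom_t \<in> ring_hom (Y_qt q t) (Y_tL t)"
    unfolding Y_qt_def Y_tL_def
  proof (rule subst_hom_ring_hom, goal_cases)
    case (7 x)
    have "0 \<in> carrier (Y_tL t)" unfolding Y_tL_def by (rule gen_closed)
    then show ?case
      using 7 w unfolding Y_tL_def[symmetric]
      by (auto simp: hom_t_rules simp del: wvar.simps)
  qed (auto simp: phi_add)
  then show ?thesis
    unfolding is_Pi_t_def by (simp add: hom_t_rules phi_t_wvar del: wvar.simps)
qed

lemma is_Pi_t_Pi_t: "is_Pi_t q t (Pi_t q t)"
  unfolding Pi_t_def by (rule someI[of "is_Pi_t q t", OF is_Pi_t_hom_t])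

lemma is_Pi_t_unique:
  assumes h: "is_Pi_t q t h" and k: "is_Pi_t q t k" and x: "x \<in> carrier (Y_qt q t)"
  shows "h x = k x"
proof -
  have val: "h (Ymon (wvar q i a)) = hom_t (Ymon (wvar q i a))"
    if "a \<in> qt_lattice q t" "is_Pi_t q t h" for h i a
    using that is_Pi_t_hom_t
    by (cases i) (auto elim!: qt_latticeE simp: is_Pi_t_def simp del: wvar.simps)
  have inv: "h (Ymon (- wvar q i a)) = hom_t (Ymon (- wvar q i a))"
    if "a \<in> qt_lattice q t" "is_Pi_t q t h" for h i a
  proof -
    note c = Y_qt_mem(1,2)[OF that(1), of i]
    have h: "h \<in> ring_hom (Y_qt q t) (Y_tL t)" using that by (simp add: is_Pi_t_def)
    have "h (Ymon (wvar q i a)) * h (Ymon (- wvar q i a)) = 1"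
      using ring_hom_mult[OF h c] ring_hom_one[OF h] by (simp add: Y_qt_def Y_tL_def Ymon_simps)
    then have "Ymon (- phi_t (wvar q i a)) * Ymon (phi_t (wvar q i a)) * h (Ymon (- wvar q i a))
        = Ymon (- phi_t (wvar q i a))"
      unfolding val[OF that] by (simp add: mult.assoc hom_t_rules)
    then show ?thesis by (simp add: Ymon_simps hom_t_rules phi_add)
  qed
  show ?thesis
  proof (rule gen_hom_unique[OF h[unfolded is_Pi_t_def Y_qt_def Y_tL_def, THEN conjunct1]
        k[unfolded is_Pi_t_def Y_qt_def Y_tL_def, THEN conjunct1] _ x[unfolded Y_qt_def]])
    fix x assume "x \<in> {Ymon (wvar q i a) | i a. a \<in> qt_lattice q t} \<union> {Ymon (- wvar q i a) | i a. a \<in> qt_lattice q t} \<union>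
      {beta * Ymon (yvar i a) | i a. a \<in> qt_lattice q t} \<union>
      {beta * Ymon (- yvar i a) | i a. a \<in> qt_lattice q t} \<union> {beta}"
    then consider i a where "a \<in> qt_lattice q t" "x = Ymon (wvar q i a)"
      | i a where "a \<in> qt_lattice q t" "x = Ymon (- wvar q i a)"
      | i a where "a \<in> qt_lattice q t" "x = beta * Ymon (yvar i a) \<or> x = beta * Ymon (- yvar i a)"
      | "x = beta" by blast
    then show "h x = k x"
    proof cases
      case 1 then show ?thesis using val[OF _ h] val[OF _ k] by simp
    next
      case 2 then show ?thesis using inv[OF _ h] inv[OF _ k] by simp
    next
      case 3 then show ?thesis using h k by (auto simp: is_Pi_t_def)
    next
      case 4 then show ?thesis using h k by (simp add: is_Pi_t_def)
    qed
  qed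
qed

lemma ops:
  "x \<otimes>\<^bsub>Y_all q t\<^esub> z = x * z" "x \<oplus>\<^bsub>Y_all q t\<^esub> z = x + z" "\<one>\<^bsub>Y_all q t\<^esub> = 1"
  "x \<otimes>\<^bsub>Y_qt q t\<^esub> z = x * z" "x \<oplus>\<^bsub>Y_qt q t\<^esub> z = x + z" "\<one>\<^bsub>Y_qt q t\<^esub> = 1"
  by (simp_all add: Y_all_def Y_qt_def)

lemma Y_closed:
  "1 \<in> carrier (Y_all q t)" "0 \<in> carrier (Y_all q t)"
  "x \<in> carrier (Y_all q t) \<Longrightarrow> - x \<in> carrier (Y_all q t)"
  "x \<in> carrier (Y_all q t) \<Longrightarrow> z \<in> carrier (Y_all q t) \<Longrightarrow> x + z \<in> carrier (Y_all q t)"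
  "x \<in> carrier (Y_all q t) \<Longrightarrow> z \<in> carrier (Y_all q t) \<Longrightarrow> x * z \<in> carrier (Y_all q t)"
  "1 \<in> carrier (Y_qt q t)" "0 \<in> carrier (Y_qt q t)"
  "x \<in> carrier (Y_qt q t) \<Longrightarrow> - x \<in> carrier (Y_qt q t)"
  "x \<in> carrier (Y_qt q t) \<Longrightarrow> z \<in> carrier (Y_qt q t) \<Longrightarrow> x + z \<in> carrier (Y_qt q t)"
  "x \<in> carrier (Y_qt q t) \<Longrightarrow> z \<in> carrier (Y_qt q t) \<Longrightarrow> x * z \<in> carrier (Y_qt q t)"
  unfolding Y_all_def Y_qt_def by (fact gen_closed)+

lemma beta_mem: "beta \<in> carrier (Y_all q t)" "beta \<in> carrier (Y_qt q t)"
  unfolding Y_all_def Y_qt_def by (rule gen_closed(3), blast)+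

lemma Y_qt_subset_Y_all: "carrier (Y_qt q t) \<subseteq> carrier (Y_all q t)"
proof
  fix x assume "x \<in> carrier (Y_qt q t)"
  have w: "Ymon (wvar q i a) \<in> carrier (Y_all q t)" "Ymon (- wvar q i a) \<in> carrier (Y_all q t)"
    if "a \<in> qt_lattice q t" for i a
  proof -
    obtain l m where a: "a = q powi l * t powi m" using \<open>a \<in> qt_lattice q t\<close> by (rule qt_latticeE)
    have "a / q^2 = q powi (l - 2) * t powi m" "a * q^2 = q powi (l + 2) * t powi m"
      using nz a by (simp_all add: power_int_diff power_int_add)
    then have "a / q^2 \<in> qt_lattice q t" "a * q^2 \<in> qt_lattice q t"
      unfolding qt_lattice_def by blast+
    note m = Y_all_mem[OF that] Y_all_mem[OF this(1)] Y_all_mem[OF this(2)]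
    have "(Ymon (wvar q N2 a) :: lmon \<Rightarrow>\<^sub>0 int poly) = Ymon (yvar N2 (a / q^2)) * Ymon (yvar N2 a) * Ymon (yvar N2 (a * q^2))"
      "(Ymon (- wvar q N2 a) :: lmon \<Rightarrow>\<^sub>0 int poly) = Ymon (- yvar N2 (a / q^2)) * Ymon (- yvar N2 a) * Ymon (- yvar N2 (a * q^2))"
      by (simp_all add: Ymon_simps algebra_simps)
    then have "Ymon (wvar q N2 a) \<in> carrier (Y_all q t)" "Ymon (- wvar q N2 a) \<in> carrier (Y_all q t)"
      by (simp_all only: Y_closed(5) m)
    then show "Ymon (wvar q i a) \<in> carrier (Y_all q t)" "Ymon (- wvar q i a) \<in> carrier (Y_all q t)"
      using m(1,2)[of N1] by (cases i; simp only: wvar.simps)+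
  qed
  show "x \<in> carrier (Y_all q t)"
    using \<open>x \<in> carrier (Y_qt q t)\<close> unfolding Y_qt_def
  proof (induction rule: gen_induct)
    case (incl x)
    then consider i a where "a \<in> qt_lattice q t" "x = Ymon (wvar q i a) \<or> x = Ymon (- wvar q i a)"
      | i a where "a \<in> qt_lattice q t" "x = beta * Ymon (yvar i a) \<or> x = beta * Ymon (- yvar i a)"
      | "x = beta" by blast
    then show ?case
    proof cases
      case 1 then show ?thesis using w by blast
    next
      case 2 then show ?thesis using Y_all_mem Y_closed(5) by blast
    next
      case 3 then show ?thesis using beta_mem by blast
    qed
  qed (auto intro: Y_closed)
qed

lemma ring_hom_Pi:
  "Pi_q q t \<in> ring_hom (Y_qt q t) (Y_q q)" "Pi_t q t \<in> ring_hom (Y_qt q t) (Y_tL t)"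
proof -
  show "Pi_t q t \<in> ring_hom (Y_qt q t) (Y_tL t)" using is_Pi_t_Pi_t by (simp add: is_Pi_t_def)
  have "Pi_q q t \<in> ring_hom (Y_all q t) (Y_q q)" using is_Pi_q_Pi_q by (simp add: is_Pi_q_def)
  then show "Pi_q q t \<in> ring_hom (Y_qt q t) (Y_q q)"
    using Y_qt_subset_Y_all by (auto simp: ring_hom_def ops Pi_def subset_iff)
qed

lemma Pi_eq:
  assumes "x \<in> carrier (Y_qt q t)"
  shows "Pi_q q t x = hom_q x" "Pi_t q t x = hom_t x"
  using is_Pi_q_unique[OF is_Pi_q_Pi_q is_Pi_q_hom_q] is_Pi_t_unique[OF is_Pi_t_Pi_t is_Pi_t_hom_t]
    Y_qt_subset_Y_all assms by blast+

lemma ideal_ker_both: "ideal (ker_both q t) (Y_qt q t)"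
proof -
  have c: "cring (Y_qt q t)" "cring (Y_q q)" "cring (Y_tL t)"
    by (simp_all add: Y_qt_def Y_q_def Y_tL_def cring_gen_subring)
  have "ring_hom_ring (Y_qt q t) (Y_q q) (Pi_q q t)" "ring_hom_ring (Y_qt q t) (Y_tL t) (Pi_t q t)"
    using c ring_hom_Pi by (auto intro!: ring_hom_ringI2 dest: cring.axioms(1))
  then show ?thesis
    unfolding ker_both_def
    by (intro ring.i_intersect cring.axioms(1)[OF c(1)] ring_hom_ring.kernel_is_ideal)
qed

lemma denoted_unique:
  assumes "x \<in> denoted q t {f}" "x' \<in> denoted q t {f}" shows "x = x'"
proof -
  obtain g g' where g: "g \<in> carrier (Y_qt q t)" "(beta^2 - beta) dvd (g - f)"
      "x = a_r_coset (Y_qt q t) (ker_both q t) g"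
    and g': "g' \<in> carrier (Y_qt q t)" "(beta^2 - beta) dvd (g' - f)"
      "x' = a_r_coset (Y_qt q t) (ker_both q t) g'"
    using assms by (auto simp: denoted_def)
  have c: "g - g' \<in> carrier (Y_qt q t)" using g(1) g'(1) unfolding Y_qt_def by (rule gen_closed)
  have "(beta^2 - beta) dvd (g - g')" using dvd_diff[OF g(2) g'(2)] by simp
  then obtain h where h: "g - g' = (beta * beta - beta) * h" by (auto simp: power2_eq_square)
  have "hom_q (beta * beta + - beta) = 0" "hom_t (beta * beta + - beta) = 0"
    by (simp_all only: hom_q_rules hom_t_rules) simp_all
  then have "hom_q (g - g') = 0" "hom_t (g - g') = 0"
    unfolding h hom_q_rules(2) hom_t_rules(2) by simp_all
  then have "g - g' \<in> ker_both q t"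
    using c Pi_eq[OF c] by (simp add: ker_both_def a_kernel_def' Y_q_def Y_tL_def)
  interpret cring "Y_qt q t" by (simp add: Y_qt_def cring_gen_subring)
  have "g \<ominus>\<^bsub>Y_qt q t\<^esub> g' = g - g'"
  proof -
    have "g' \<oplus>\<^bsub>Y_qt q t\<^esub> (- g') = \<zero>\<^bsub>Y_qt q t\<^esub>" "- g' \<in> carrier (Y_qt q t)"
      using g'(1) by (auto simp: Y_qt_def intro: gen_closed)
    then have "\<ominus>\<^bsub>Y_qt q t\<^esub> g' = - g'" using g'(1) by (metis minus_equality a_comm)
    then show ?thesis by (simp add: a_minus_def) (simp add: Y_qt_def)
  qed
  then show ?thesis
    using quotient_eq_iff_same_a_r_cos[OF ideal_ker_both g(1) g'(1)] \<open>g - g' \<in> ker_both q t\<close> g(3) g'(3)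
    by simp
qed

definition denotable :: "(lmon \<Rightarrow>\<^sub>0 int poly) \<Rightarrow> bool" where
  "denotable f \<longleftrightarrow> (\<exists>g\<in>carrier (Y_qt q t). (beta^2 - beta) dvd (g - f))"

lemma denotable_iff: "denotable f \<longleftrightarrow> denoted q t {f} \<noteq> {}"
  by (auto simp: denotable_def denoted_def)

lemma denotable_Y_qt: "f \<in> carrier (Y_qt q t) \<Longrightarrow> denotable f"
  unfolding denotable_def by (rule bexI[of _ f]) auto

lemma denotable_add:
  assumes "denotable f" "denotable f'" shows "denotable (f + f')"
proof -
  obtain g g' where g: "g \<in> carrier (Y_qt q t)" "(beta^2 - beta) dvd (g - f)"
    "g' \<in> carrier (Y_qt q t)" "(beta^2 - beta) dvd (g' - f')"
    using assms by (auto simp: denotable_def)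
  have "g + g' \<in> carrier (Y_qt q t)" using g by (simp add: Y_closed)
  moreover have "(beta^2 - beta) dvd (g + g' - (f + f'))"
    using dvd_add[OF g(2,4)] by (simp add: algebra_simps)
  ultimately show ?thesis by (auto simp: denotable_def)
qed

lemma denotable_mult:
  assumes "denotable f" "denotable f'" shows "denotable (f * f')"
proof -
  obtain g g' where g: "g \<in> carrier (Y_qt q t)" "(beta^2 - beta) dvd (g - f)"
    "g' \<in> carrier (Y_qt q t)" "(beta^2 - beta) dvd (g' - f')"
    using assms by (auto simp: denotable_def)
  have "g * g' \<in> carrier (Y_qt q t)" using g by (simp add: Y_closed)
  moreover have "g * g' - f * f' = g * (g' - f') + (g - f) * f'" by (simp add: algebra_simps)
  then have "(beta^2 - beta) dvd (g * g' - f * f')"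
    using g by (simp add: dvd_add dvd_mult dvd_mult2)
  ultimately show ?thesis by (auto simp: denotable_def)
qed

lemma denotable_beta: "denotable beta"
  by (rule denotable_Y_qt) (rule beta_mem)

lemma denotable_cong:
  assumes "denotable f" "(beta^2 - beta) dvd (f - f')" shows "denotable f'"
proof -
  obtain g where g: "g \<in> carrier (Y_qt q t)" "(beta^2 - beta) dvd (g - f)"
    using assms by (auto simp: denotable_def)
  have "(beta^2 - beta) dvd (g - f')" using dvd_add[OF g(2) assms(2)] by simp
  with g(1) show ?thesis by (auto simp: denotable_def)
qed

lemma denotable_beta_mult:
  assumes "x \<in> carrier (Y_all q t)" shows "denotable (beta * x)"
  using assms unfolding Y_all_def
proof (induction rule: gen_induct)
  case one then show ?case using denotable_beta by simp
next
  case (incl x)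
  from incl consider i a where "a \<in> qt_lattice q t" "x = Ymon (yvar i a)"
    | i a where "a \<in> qt_lattice q t" "x = Ymon (- yvar i a)" | "x = beta" by blast
  then show ?case
    by cases (simp_all add: denotable_Y_qt Y_qt_mem denotable_mult denotable_beta)
next
  case (minus x)
  have "-1 \<in> carrier (Y_qt q t)" using Y_closed(6,8) by blast
  from denotable_mult[OF denotable_Y_qt[OF this] minus.IH] show ?case by simp
next
  case (add x z) then show ?case by (simp add: ring_distribs denotable_add)
next
  case (mult x z)
  show ?case
    by (rule denotable_cong[OF denotable_mult[OF mult.IH]], rule dvdI[of _ _ "x * z"])
       (simp add: algebra_simps power2_eq_square)
qed

lemma qt_lattice_mult: "a \<in> qt_lattice q t \<Longrightarrow> a * (q ^ k * t ^ n) \<in> qt_lattice q t"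
proof (erule qt_latticeE)
  fix l m assume "a = q powi l * t powi m"
  then have "a * (q ^ k * t ^ n) = q powi (l + int k) * t powi (m + int n)"
    using nz by (simp add: power_int_add)
  then show ?thesis unfolding qt_lattice_def by blast
qed

lemma K_gens_denotable:
  assumes "f \<in> K1_gens q t \<union> K2_gens q t" shows "denoted q t {f} \<noteq> {}"
proof -
  have dw: "denotable (Ymon (wvar q i a))" "denotable (Ymon (- wvar q i a))" if "a \<in> qt_lattice q t" for i a
    using that by (auto intro!: denotable_Y_qt Y_qt_mem)
  have dy: "denotable (Ymon (yvar N1 a))" "denotable (Ymon (- yvar N1 a))" if "a \<in> qt_lattice q t" for a
    using dw[OF that, of N1] by simp_all
  have db: "denotable (beta * Ymon (yvar i a))" "denotable (beta * Ymon (- yvar i a))"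
    if "a \<in> qt_lattice q t" for i a
    using that by (auto intro!: denotable_Y_qt Y_qt_mem)
  have A2: "Ymon (- Aexp q t N2 (a * q * t)) \<in> carrier (Y_all q t)" if a: "a \<in> qt_lattice q t" for a
  proof -
    have "(Ymon (- Aexp q t N2 (a * q * t)) :: lmon \<Rightarrow>\<^sub>0 int poly) = Ymon (- yvar N2 a) * Ymon (- yvar N2 (a * (q^2 * t^2)))
        * Ymon (yvar N1 (a * (q^1 * t^1)))"
      using nz by (simp add: Ymon_simps power2_eq_square algebra_simps)
    then show ?thesis
      by (simp only: Y_closed(5) Y_all_mem[OF a] Y_all_mem[OF qt_lattice_mult[OF a]])
  qed
  have "denotable f"
    using assms unfolding K1_gens_def K2_gens_def
  proof (elim UnE CollectE exE conjE)
    fix a assume f: "f = Ymon (yvar N1 a) * (1 + Ymon (- Aexp q t N1 (a * q ^ 3 * t)))"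
      and a: "a \<in> qt_lattice q t"
    have "f = Ymon (yvar N1 a) + Ymon (- yvar N1 (a * (q^6 * t^2))) * Ymon (wvar q N2 (a * (q^3 * t^1)))"
      using nz unfolding f
      by (simp add: Ymon_simps algebra_simps flip: power_add) (simp add: power2_eq_square eval_nat_numeral algebra_simps)
    then show ?thesis
      by (simp only: denotable_add denotable_mult dy dw a qt_lattice_mult)
  next
    fix a assume f: "f = Ymon (yvar N2 a) * Ymon (yvar N2 (a * q ^ 2)) * Ymon (yvar N2 (a * q ^ 4)) *
        (1 + beta * Ymon (- Aexp q t N2 (a * q ^ 5 * t))
           + beta * Ymon (- Aexp q t N2 (a * q ^ 5 * t)) * Ymon (- Aexp q t N2 (a * q ^ 3 * t))
           + Ymon (- Aexp q t N2 (a * q ^ 5 * t)) * Ymon (- Aexp q t N2 (a * q ^ 3 * t)) *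
             Ymon (- Aexp q t N2 (a * q * t)))" and a: "a \<in> qt_lattice q t"
    define p0 where "p0 = (Ymon (yvar N2 a) :: lmon \<Rightarrow>\<^sub>0 int poly) * Ymon (yvar N2 (a * q ^ 2)) * Ymon (yvar N2 (a * q ^ 4))"
    define u1 where "u1 = (Ymon (- Aexp q t N2 (a * q ^ 5 * t)) :: lmon \<Rightarrow>\<^sub>0 int poly)"
    define u2 where "u2 = (Ymon (- Aexp q t N2 (a * q ^ 3 * t)) :: lmon \<Rightarrow>\<^sub>0 int poly)"
    define u3 where "u3 = (Ymon (- Aexp q t N2 (a * q * t)) :: lmon \<Rightarrow>\<^sub>0 int poly)"
    have p0: "p0 = Ymon (wvar q N2 (a * (q^2 * t^0)))"
      using nz by (simp add: p0_def Ymon_simps power2_eq_square eval_nat_numeral algebra_simps)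
    have PXYZ: "p0 * u1 * u2 * u3 = Ymon (- wvar q N2 (a * (q^4 * t^2))) * Ymon (yvar N1 (a * (q^5 * t^1)))
        * Ymon (yvar N1 (a * (q^3 * t^1))) * Ymon (yvar N1 (a * (q^1 * t^1)))"
      using nz by (simp add: p0_def u1_def u2_def u3_def Ymon_simps power2_eq_square eval_nat_numeral algebra_simps)
    have XY: "u1 \<in> carrier (Y_all q t)" "u2 \<in> carrier (Y_all q t)" "p0 \<in> carrier (Y_all q t)"
    proof -
      have "u1 = Ymon (- Aexp q t N2 (a * (q^4 * t^0) * q * t))" "u2 = Ymon (- Aexp q t N2 (a * (q^2 * t^0) * q * t))"
        by (simp_all add: u1_def u2_def eval_nat_numeral mult.assoc)
      then show "u1 \<in> carrier (Y_all q t)" "u2 \<in> carrier (Y_all q t)"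
        by (simp_all only: A2 qt_lattice_mult[OF a])
      show "p0 \<in> carrier (Y_all q t)"
        using Y_qt_mem(1)[OF qt_lattice_mult[OF a]] Y_qt_subset_Y_all unfolding p0 by blast
    qed
    have "f = p0 + beta * (p0 * u1) + beta * (p0 * u1 * u2) + p0 * u1 * u2 * u3"
      unfolding f p0_def[symmetric] u1_def[symmetric] u2_def[symmetric] u3_def[symmetric]
      by (simp add: algebra_simps)
    moreover have "denotable p0" "denotable (p0 * u1 * u2 * u3)"
      unfolding PXYZ by (simp_all only: p0 denotable_mult dy dw a qt_lattice_mult)
    ultimately show ?thesis
      by (simp only: denotable_add denotable_beta_mult Y_closed(5) XY)
  next
    fix a assume f: "f = beta * Ymon (yvar N2 a) * (1 + Ymon (- Aexp q t N2 (a * q * t)))"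
      and a: "a \<in> qt_lattice q t"
    show ?thesis unfolding f mult.assoc[of beta]
      by (intro denotable_beta_mult Y_closed(1,4,5) Y_all_mem a A2)
  qed (simp_all only: dw dy db denotable_beta singleton_iff)
  then show ?thesis by (simp add: denotable_iff)
qed

end

end

theory Submission
  imports Defs
begin

text \<open>
  Since \<open>\<beta>\<close> maps to \<open>1\<close> under \<open>\<Pi>\<^sub>q\<close> and to \<open>0\<close> under \<open>\<Pi>\<^sub>t\<close>, it is the idempotent \<open>(1, 0)\<close>, and
  each of the subalgebras \<open>K1\<close>, \<open>K2\<close> is the full product of its two specializations. The claim thus
  splits into one about \<open>q\<close>-characters of type \<open>G\<^sub>2\<close> and one about \<open>q\<close>-characters of twisted type
  \<open>D\<^sub>4\<^sup>(\<^sup>3\<^sup>)\<close>. In both cases there is a linear weight, positive on the variables, which every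
  \<open>A\<^sup>-\<^sup>1\<close> lowers. A monomial of maximal weight in an element of \<open>K1 \<inter> K2\<close> is dominant, which gives
  uniqueness. For existence it is enough to exhibit elements of \<open>K1 \<inter> K2\<close> with leading monomial a single
  variable (the characters of the fundamental representations, with 15 and 7, respectively 8 and
  29 monomials): products of these have every dominant leading monomial, and the remaining
  dominant monomials are removed by induction on the weight.
\<close>

section \<open>Two commuting rank one conditions\<close>

lemma lookup_of_int_mult:
  "Poly_Mapping.lookup (of_int c * g :: 'a::comm_monoid_add \<Rightarrow>\<^sub>0 'b::comm_ring_1) a = of_int c * Poly_Mapping.lookup g a"
  by (induction c rule: int_induct[of _ 0]) (simp_all add: algebra_simps lookup_add lookup_minus)

text \<open>
  \<open>V\<close> is the set of variables in use, and \<open>B v\<close> is the exponent of the second monomial \<open>Y\<^sub>v A\<^sup>-\<^sup>1\<close> of the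
  generator of \<open>K i\<close> with first monomial \<open>Y\<^sub>v\<close>.
\<close>

locale sl2_pair =
  fixes V :: "(node \<times> complex) set" and wt :: "lmon \<Rightarrow> int" and B :: "node \<times> complex \<Rightarrow> lmon"
  assumes wt_add: "wt (M + N) = wt M + wt N"
    and wt_nonneg: "dominant M \<Longrightarrow> 0 \<le> wt M"
    and wt_B: "v \<in> V \<Longrightarrow> wt (B v) < wt (Poly_Mapping.single v 1)"
    and keys_B: "v \<in> V \<Longrightarrow> Poly_Mapping.keys (B v) \<subseteq> V"
begin

section \<open>Rank one subrings attached to a node\<close>

definition chi :: "node \<times> complex \<Rightarrow> lmon \<Rightarrow>\<^sub>0 int" where
  "chi v = Ymon (Poly_Mapping.single v 1) + Ymon (B v)"

definition gens :: "node \<Rightarrow> (lmon \<Rightarrow>\<^sub>0 int) set" where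
  "gens i = {chi v | v. v \<in> V \<and> fst v = i} \<union>
     {Ymon (Poly_Mapping.single v 1) | v. v \<in> V \<and> fst v \<noteq> i} \<union>
     {Ymon (- Poly_Mapping.single v 1) | v. v \<in> V \<and> fst v \<noteq> i}"

definition K :: "node \<Rightarrow> (lmon \<Rightarrow>\<^sub>0 int) set" where
  "K i = carrier (gen_subring (gens i))"

lemma K_closed:
  "1 \<in> K i" "0 \<in> K i" "f \<in> gens i \<Longrightarrow> f \<in> K i" "f \<in> K i \<Longrightarrow> - f \<in> K i"
  "f \<in> K i \<Longrightarrow> g \<in> K i \<Longrightarrow> f + g \<in> K i" "f \<in> K i \<Longrightarrow> g \<in> K i \<Longrightarrow> f - g \<in> K i"
  "f \<in> K i \<Longrightarrow> g \<in> K i \<Longrightarrow> f * g \<in> K i"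
  unfolding K_def by (fact gen_closed)+

lemma K_sum: "(\<And>j. j \<in> J \<Longrightarrow> f j \<in> K i) \<Longrightarrow> (\<Sum>j\<in>J. f j) \<in> K i"
  by (induction J rule: infinite_finite_induct) (auto intro: K_closed)

lemma K_prod: "(\<And>j. j \<in> J \<Longrightarrow> f j \<in> K i) \<Longrightarrow> (\<Prod>j\<in>J. f j) \<in> K i"
  by (induction J rule: infinite_finite_induct) (auto intro: K_closed)

lemma K_power: "f \<in> K i \<Longrightarrow> f ^ n \<in> K i"
  by (induction n) (auto intro: K_closed)

lemma K_of_int: "of_int k \<in> K i"
  by (induction k rule: int_induct[of _ 0]) (auto intro: K_closed)

lemma K_chi: "v \<in> V \<Longrightarrow> fst v = i \<Longrightarrow> chi v \<in> K i"
  by (rule K_closed(3)) (unfold gens_def, blast)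

lemma K_Ymon:
  assumes "v \<in> V" "fst v \<noteq> i"
  shows "Ymon (Poly_Mapping.single v 1) \<in> K i" "Ymon (- Poly_Mapping.single v 1) \<in> K i"
  by (rule K_closed(3), unfold gens_def, use assms in blast)+

text \<open>Every \<open>B v\<close> stays inside \<open>V\<close>, so no generator leaves it. Since
  \<open>node_dominant\<close> includes support in \<open>V\<close>, this is what allows dominance
  to be tested one node at a time.\<close>

lemma K_support:
  assumes "f \<in> K i" "M \<in> Poly_Mapping.keys f" shows "Poly_Mapping.keys M \<subseteq> V"
  using assms(1)[unfolded K_def] assms(2)
proof (induction arbitrary: M rule: gen_induct)
  case one then show ?case by (simp flip: single_one split: if_splits)
next
  case (incl f)
  then consider v where "v \<in> V" "f = chi v" | v where "v \<in> V" "f = Ymon (Poly_Mapping.single v 1)"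
    | v where "v \<in> V" "f = Ymon (- Poly_Mapping.single v 1)"
    unfolding gens_def by blast
  then show ?case
  proof cases
    case 1
    then have "M = Poly_Mapping.single v 1 \<or> M = B v"
      using incl.prems keys_add[of "Ymon (Poly_Mapping.single v 1)" "Ymon (B v)"]
      by (auto simp: chi_def Ymon_def)
    then show ?thesis using 1 keys_B[OF 1(1)] by fastforce
  qed (use incl.prems in \<open>simp_all add: Ymon_def\<close>)
next
  case (add f g) then show ?case using keys_add[of f g] by blast
next
  case (mult f g)
  then obtain a b where "a \<in> Poly_Mapping.keys f" "b \<in> Poly_Mapping.keys g" "M = a + b"
    using keys_mult[of f g] by blast
  then show ?case using mult.IH keys_add[of a b] by blast
qed simp

text \<open>Stronger than maximality of the weight, which does not separate monomials: the
  coefficient of \<open>M\<close> must be 1 and every other monomial must lie strictly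
  below.\<close>

definition lead :: "(lmon \<Rightarrow>\<^sub>0 int) \<Rightarrow> lmon \<Rightarrow> bool" where
  "lead f M \<longleftrightarrow> (\<forall>N\<in>Poly_Mapping.keys (f - Ymon M). wt N < wt M)"

lemma keys_Ymon: "Poly_Mapping.keys (Ymon M :: lmon \<Rightarrow>\<^sub>0 int) = {M}"
  by (simp add: Ymon_def)

lemma lead_Ymon: "lead (Ymon M) M"
  by (simp add: lead_def)

lemma lead_chi: "v \<in> V \<Longrightarrow> lead (chi v) (Poly_Mapping.single v 1)"
  by (simp add: lead_def chi_def keys_Ymon wt_B)

text \<open>With each factor split into leading monomial and remainder, all terms involving a
  remainder drop in weight because the weight is additive.\<close>

lemma lead_mult:
  assumes "lead f M" "lead g N" shows "lead (f * g) (M + N)"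
  unfolding lead_def
proof
  fix P assume P: "P \<in> Poly_Mapping.keys (f * g - Ymon (M + N))"
  have "f * g - Ymon (M + N) = (f - Ymon M) * (g - Ymon N) + Ymon M * (g - Ymon N) + (f - Ymon M) * Ymon N"
    by (simp add: algebra_simps Ymon_simps)
  then have "P \<in> Poly_Mapping.keys ((f - Ymon M) * (g - Ymon N)) \<union> Poly_Mapping.keys (Ymon M * (g - Ymon N))
      \<union> Poly_Mapping.keys ((f - Ymon M) * Ymon N)"
    using P subsetD[OF keys_add] by (metis UnCI UnE)
  then show "wt P < wt (M + N)"
  proof (elim UnE)
    assume "P \<in> Poly_Mapping.keys ((f - Ymon M) * (g - Ymon N))"
    then obtain a b where "P = a + b" "wt a < wt M" "wt b < wt N"
      using assms keys_mult[of "f - Ymon M" "g - Ymon N"] unfolding lead_def by blast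
    then show ?thesis by (simp add: wt_add)
  next
    assume "P \<in> Poly_Mapping.keys (Ymon M * (g - Ymon N))"
    then obtain b where "P = M + b" "wt b < wt N"
      using assms(2) keys_mult[of "Ymon M" "g - Ymon N"] unfolding lead_def keys_Ymon by blast
    then show ?thesis by (simp add: wt_add)
  next
    assume "P \<in> Poly_Mapping.keys ((f - Ymon M) * Ymon N)"
    then obtain a where "P = a + N" "wt a < wt M"
      using assms(1) keys_mult[of "f - Ymon M" "Ymon N"] unfolding lead_def keys_Ymon by blast
    then show ?thesis by (simp add: wt_add)
  qed
qed

lemma lead_prod: "finite S \<Longrightarrow> (\<And>s. s \<in> S \<Longrightarrow> lead (f s) (M s)) \<Longrightarrow> lead (\<Prod>s\<in>S. f s) (\<Sum>s\<in>S. M s)"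
  by (induction S rule: finite_induct) (use lead_Ymon[of 0] in \<open>auto simp: Ymon_simps lead_mult\<close>)

lemma lead_power: "lead f M \<Longrightarrow> lead (f ^ n) (\<Sum>_<n. M)"
  using lead_prod[of "{..<n}" "\<lambda>_. f" "\<lambda>_. M"] by simp

text \<open>The remainder cannot contribute at a monomial of weight at least \<open>wt M\<close>.
  This is how coefficients near the top are read off.\<close>

lemma lead_lookup:
  assumes "lead f M" "wt M \<le> wt N"
  shows "Poly_Mapping.lookup f N = (if N = M then 1 else 0)"
proof -
  have "N \<notin> Poly_Mapping.keys (f - Ymon M)"
    using assms unfolding lead_def using linorder_not_less by blast
  then show ?thesis by (simp add: in_keys_iff lookup_minus Ymon_def lookup_single when_def)
qed

lemma sum_lessThan_single:
  "(\<Sum>_<n. Poly_Mapping.single v 1) = (Poly_Mapping.single v (int n) :: lmon)"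
  by (induction n) (simp_all add: single_add[symmetric] add.commute)

text \<open>\<open>chi v\<close> is not a unit, so only nonnegative exponents make sense at node
  \<open>i\<close>; \<open>nat\<close> gives the others the default value 1. At the other node
  Laurent monomials are available.\<close>

definition e :: "node \<Rightarrow> node \<times> complex \<Rightarrow> int \<Rightarrow> lmon \<Rightarrow>\<^sub>0 int" where
  "e i v n = (if fst v = i then chi v ^ nat n else Ymon (Poly_Mapping.single v n))"

text \<open>
  On node-dominant monomials \<open>E i\<close> is multiplicative with leading monomial \<open>M\<close>, so the \<open>E i M\<close> form a
  basis of \<open>K i\<close> that is triangular with respect to the weight.
\<close>

definition E :: "node \<Rightarrow> lmon \<Rightarrow> lmon \<Rightarrow>\<^sub>0 int" where
  "E i M = (\<Prod>v\<in>Poly_Mapping.keys M. e i v (Poly_Mapping.lookup M v))"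

definition node_dominant :: "node \<Rightarrow> lmon \<Rightarrow> bool" where
  "node_dominant i M \<longleftrightarrow> Poly_Mapping.keys M \<subseteq> V \<and> (\<forall>a. 0 \<le> Poly_Mapping.lookup M (i, a))"

lemma dominant_iff:
  "Poly_Mapping.keys M \<subseteq> V \<Longrightarrow> dominant M \<longleftrightarrow> (\<forall>i. node_dominant i M)"
  by (auto simp: dominant_def node_dominant_def)

lemma node_dominant_add: "node_dominant i M \<Longrightarrow> node_dominant i N \<Longrightarrow> node_dominant i (M + N)"
  using keys_add[of M N] by (auto simp: node_dominant_def lookup_add)

lemma e_0: "e i v 0 = 1"
  by (simp add: e_def Ymon_simps)

lemma E_superset:
  "finite S \<Longrightarrow> Poly_Mapping.keys M \<subseteq> S \<Longrightarrow> E i M = (\<Prod>v\<in>S. e i v (Poly_Mapping.lookup M v))"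
  unfolding E_def by (rule prod.mono_neutral_left) (auto simp: in_keys_iff e_0)

text \<open>Nonnegative exponents at node \<open>i\<close> make \<open>nat\<close> additive, so that
  the powers of \<open>chi v\<close> multiply.\<close>

lemma E_add:
  assumes "node_dominant i M" "node_dominant i N" shows "E i (M + N) = E i M * E i N"
proof -
  have "e i v (Poly_Mapping.lookup (M + N) v) = e i v (Poly_Mapping.lookup M v) * e i v (Poly_Mapping.lookup N v)" for v
    using assms by (cases v) (auto simp: e_def node_dominant_def lookup_add nat_add_distrib power_add
        Ymon_simps single_add)
  then show ?thesis
    using E_superset[of "Poly_Mapping.keys M \<union> Poly_Mapping.keys N"] keys_add[of M N]
    by (simp add: prod.distrib)
qed

lemma E_lead:
  assumes "node_dominant i M" shows "lead (E i M) M"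
proof -
  have "lead (e i v (Poly_Mapping.lookup M v)) (Poly_Mapping.single v (Poly_Mapping.lookup M v))"
    if "v \<in> Poly_Mapping.keys M" for v
  proof (cases "fst v = i")
    case True
    then have "v \<in> V" "0 \<le> Poly_Mapping.lookup M v" using that assms
      by (cases v; auto simp: node_dominant_def)+
    then show ?thesis
      using lead_power[OF lead_chi, of v "nat (Poly_Mapping.lookup M v)"] True
      by (simp add: e_def sum_lessThan_single)
  qed (simp add: e_def lead_Ymon)
  then have "lead (E i M) (\<Sum>v\<in>Poly_Mapping.keys M. Poly_Mapping.single v (Poly_Mapping.lookup M v))"
    unfolding E_def by (intro lead_prod) auto
  then show ?thesis by (simp flip: sum_singles)
qed

section \<open>Triangular expansion of the elements of \<open>K i\<close>\<close>

definition ext :: "node \<Rightarrow> (lmon \<Rightarrow>\<^sub>0 int) \<Rightarrow> lmon \<Rightarrow>\<^sub>0 int" where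
  "ext i p = (\<Sum>M\<in>Poly_Mapping.keys p. of_int (Poly_Mapping.lookup p M) * E i M)"

lemma ext_superset:
  "finite S \<Longrightarrow> Poly_Mapping.keys p \<subseteq> S \<Longrightarrow>
    ext i p = (\<Sum>M\<in>S. of_int (Poly_Mapping.lookup p M) * E i M)"
  unfolding ext_def by (rule sum.mono_neutral_left) (auto simp: in_keys_iff)

lemma ext_add: "ext i (p + r) = ext i p + ext i r"
  using ext_superset[of "Poly_Mapping.keys p \<union> Poly_Mapping.keys r"] keys_add[of p r]
  by (simp add: lookup_add sum.distrib algebra_simps)

lemma ext_0: "ext i 0 = 0" by (simp add: ext_def)

lemma ext_single: "ext i (Poly_Mapping.single M c) = of_int c * E i M"
  by (cases "c = 0") (simp_all add: ext_def)

lemma ext_sum: "ext i (\<Sum>j\<in>J. p j) = (\<Sum>j\<in>J. ext i (p j))"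
  by (induction J rule: infinite_finite_induct) (simp_all add: ext_0 ext_add)

lemma ext_mult:
  assumes "\<forall>M\<in>Poly_Mapping.keys p. node_dominant i M" "\<forall>M\<in>Poly_Mapping.keys r. node_dominant i M"
  shows "ext i (p * r) = ext i p * ext i r"
proof -
  have "p * r = (\<Sum>M\<in>Poly_Mapping.keys p. \<Sum>N\<in>Poly_Mapping.keys r.
      Poly_Mapping.single (M + N) (Poly_Mapping.lookup p M * Poly_Mapping.lookup r N))"
    by (subst sum_singles[of p], subst sum_singles[of r]) (simp add: sum_product mult_single)
  then have "ext i (p * r) = (\<Sum>M\<in>Poly_Mapping.keys p. \<Sum>N\<in>Poly_Mapping.keys r.
      of_int (Poly_Mapping.lookup p M * Poly_Mapping.lookup r N) * (E i M * E i N))"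
    using assms by (simp add: ext_sum ext_single E_add)
  then show ?thesis by (simp add: ext_def sum_product algebra_simps)
qed

text \<open>Each generator is itself some \<open>E i M\<close>, and by \<open>ext_mult\<close> the
  combinations of node-dominant \<open>E i M\<close> are closed under products.\<close>

lemma K_ext:
  assumes "f \<in> K i"
  shows "\<exists>p. (\<forall>M\<in>Poly_Mapping.keys p. node_dominant i M) \<and> f = ext i p"
  using assms[unfolded K_def]
proof (induction rule: gen_induct)
  case one
  then show ?case
    by (intro exI[of _ "Poly_Mapping.single 0 1"])
       (simp add: ext_single E_def node_dominant_def del: single_one)
next
  case (incl f)
  then consider v where "v \<in> V" "fst v = i" "f = chi v"
    | v c where "v \<in> V" "fst v \<noteq> i" "f = Ymon (Poly_Mapping.single v c)" "c \<noteq> 0"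
    unfolding gens_def by (auto simp flip: single_uminus)
  then show ?case
  proof cases
    case 1
    then show ?thesis
      by (intro exI[of _ "Poly_Mapping.single (Poly_Mapping.single v 1) 1"])
         (auto simp: ext_single E_def e_def node_dominant_def lookup_single when_def)
  next
    case 2
    then show ?thesis
      by (intro exI[of _ "Poly_Mapping.single (Poly_Mapping.single v c) 1"])
         (auto simp: ext_single E_def e_def node_dominant_def lookup_single when_def)
  qed
next
  case (minus f)
  then obtain p where "\<forall>M\<in>Poly_Mapping.keys p. node_dominant i M" "f = ext i p" by blast
  moreover have "ext i (- p) = - ext i p"
    using ext_add[of i p "- p"] by (simp add: ext_0 eq_neg_iff_add_eq_0 add.commute)
  ultimately show ?case by (intro exI[of _ "- p"]) simp
next
  case (add f g)
  then obtain p r where "\<forall>M\<in>Poly_Mapping.keys p. node_dominant i M" "f = ext i p"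
    "\<forall>M\<in>Poly_Mapping.keys r. node_dominant i M" "g = ext i r" by blast
  then show ?case using keys_add[of p r] by (intro exI[of _ "p + r"]) (auto simp: ext_add)
next
  case (mult f g)
  then obtain p r where "\<forall>M\<in>Poly_Mapping.keys p. node_dominant i M" "f = ext i p"
    "\<forall>M\<in>Poly_Mapping.keys r. node_dominant i M" "g = ext i r" by blast
  moreover from this have "\<forall>M\<in>Poly_Mapping.keys (p * r). node_dominant i M"
    using keys_mult[of p r] node_dominant_add by blast
  ultimately show ?case by (intro exI[of _ "p * r"]) (simp add: ext_mult)
qed

text \<open>At the highest weight the expansion in the \<open>E i N\<close> and the expansion in
  monomials have the same coefficients. So a top monomial of \<open>f\<close> labels a basis
  element, and such labels are node-dominant.\<close>

lemma top_node_dominant: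
  assumes "f \<in> K i" "M \<in> Poly_Mapping.keys f" "\<forall>N\<in>Poly_Mapping.keys f. wt N \<le> wt M"
  shows "node_dominant i M"
proof -
  obtain p where p: "\<forall>M\<in>Poly_Mapping.keys p. node_dominant i M" "f = ext i p"
    using K_ext[OF assms(1)] by blast
  \<comment> \<open>No label in the expansion has weight above \<open>wt L\<close>, so only the
    basis element with label \<open>L\<close> contributes to the coefficient of
    \<open>L\<close>.\<close>
  have lk: "Poly_Mapping.lookup f L = Poly_Mapping.lookup p L"
    if "\<forall>N\<in>Poly_Mapping.keys p. wt N \<le> wt L" for L
  proof -
    have "Poly_Mapping.lookup f L = (\<Sum>N\<in>Poly_Mapping.keys p. Poly_Mapping.lookup p N * (if L = N then 1 else 0))"
      unfolding p(2) ext_def lookup_sum lookup_of_int_mult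
      by (rule sum.cong) (use p(1) that in \<open>auto simp: lead_lookup[OF E_lead]\<close>)
    also have "\<dots> = (\<Sum>N\<in>Poly_Mapping.keys p. if L = N then Poly_Mapping.lookup p N else 0)"
      by (rule sum.cong) auto
    finally show ?thesis by (simp add: in_keys_iff)
  qed
  have "Poly_Mapping.keys p \<noteq> {}" using assms(2) p(2) by (auto simp: ext_def)
  then have "Max (wt ` Poly_Mapping.keys p) \<in> wt ` Poly_Mapping.keys p" by (intro Max_in) auto
  then obtain L where L: "L \<in> Poly_Mapping.keys p" "wt L = Max (wt ` Poly_Mapping.keys p)" by auto
  then have Lm: "\<forall>N\<in>Poly_Mapping.keys p. wt N \<le> wt L" by simp
  then have "L \<in> Poly_Mapping.keys f" using L(1) lk by (simp add: in_keys_iff)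
  \<comment> \<open>\<open>L\<close> occurs in \<open>f\<close>, so its weight is at most that of
    \<open>M\<close>, and \<open>lk\<close> applies at \<open>M\<close> too.\<close>
  then have "\<forall>N\<in>Poly_Mapping.keys p. wt N \<le> wt M" using Lm assms(3) by fastforce
  then have "M \<in> Poly_Mapping.keys p" using lk assms(2) by (simp add: in_keys_iff)
  then show ?thesis using p(1) by blast
qed

text \<open>The uniqueness half: a monomial of greatest weight in a nonzero element would be
  node-dominant for both nodes, hence dominant.\<close>

lemma eq_0_if_no_dominant:
  assumes "\<And>i. f \<in> K i" "\<forall>M\<in>Poly_Mapping.keys f. \<not> dominant M"
  shows "f = 0"
proof (rule ccontr)
  assume "f \<noteq> 0"
  then have "Max (wt ` Poly_Mapping.keys f) \<in> wt ` Poly_Mapping.keys f" by (intro Max_in) auto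
  then obtain L where L: "L \<in> Poly_Mapping.keys f" "wt L = Max (wt ` Poly_Mapping.keys f)" by auto
  then have "node_dominant i L" for i by (intro top_node_dominant[OF assms(1)]) auto
  then have "dominant L" using dominant_iff[OF K_support[OF assms(1) L(1)]] by blast
  then show False using assms(2) L(1) by blast
qed

end

text \<open>Only the leading monomial of a fundamental element is prescribed; further dominant
  monomials are allowed and get removed later.\<close>

locale sl2_pair_fundamental = sl2_pair +
  assumes fundamental: "v \<in> V \<Longrightarrow> \<exists>f. (\<forall>i. f \<in> K i) \<and> lead f (Poly_Mapping.single v 1)"
begin

text \<open>A dominant monomial is a product of variables and leading monomials multiply, so
  products of powers of the fundamental elements suffice.\<close>

lemma exists_lead:
  assumes "dominant M" "Poly_Mapping.keys M \<subseteq> V"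
  shows "\<exists>f. (\<forall>i. f \<in> K i) \<and> lead f M"
proof -
  obtain F where F: "\<And>v i. v \<in> V \<Longrightarrow> F v \<in> K i" "\<And>v. v \<in> V \<Longrightarrow> lead (F v) (Poly_Mapping.single v 1)"
    using fundamental by metis
  define f where "f = (\<Prod>v\<in>Poly_Mapping.keys M. F v ^ nat (Poly_Mapping.lookup M v))"
  have "f \<in> K i" for i
    unfolding f_def using F assms by (intro K_prod K_power) auto
  moreover have "lead f (\<Sum>v\<in>Poly_Mapping.keys M. Poly_Mapping.single v (Poly_Mapping.lookup M v))"
    unfolding f_def
  proof (intro lead_prod)
    fix v assume "v \<in> Poly_Mapping.keys M"
    then have "lead (F v) (Poly_Mapping.single v 1)" using F(2) assms(2) by blast
    from lead_power[OF this, of "nat (Poly_Mapping.lookup M v)"]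
    show "lead (F v ^ nat (Poly_Mapping.lookup M v)) (Poly_Mapping.single v (Poly_Mapping.lookup M v))"
      using assms(1) by (cases v) (simp add: dominant_def sum_lessThan_single)
  qed simp
  ultimately show ?thesis by (auto simp flip: sum_singles)
qed

text \<open>Induction on a strict bound for the weights in \<open>d\<close>. Matching leading terms
  leaves an error of smaller weight, whose dominant part is corrected by the induction
  hypothesis.\<close>

lemma exists_with_dominant_part_bounded:
  assumes "\<forall>M\<in>Poly_Mapping.keys d. dominant M \<and> Poly_Mapping.keys M \<subseteq> V \<and> wt M < int n"
  shows "\<exists>F. (\<forall>i. F \<in> K i) \<and> (\<forall>M\<in>Poly_Mapping.keys (F - d). \<not> dominant M)"
  using assms
proof (induction n arbitrary: d)
  case 0
  \<comment> \<open>Dominant monomials have nonnegative weight, so the strict bound 0 leaves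
    nothing.\<close>
  then have "Poly_Mapping.keys d = {}" using wt_nonneg by fastforce
  then have "d = 0" by simp
  then show ?case by (intro exI[of _ 0]) (simp add: K_closed)
next
  case (Suc n)
  obtain F where F: "\<And>M i. M \<in> Poly_Mapping.keys d \<Longrightarrow> F M \<in> K i"
    "\<And>M. M \<in> Poly_Mapping.keys d \<Longrightarrow> lead (F M) M"
    using exists_lead Suc.prems by metis
  define f where "f = (\<Sum>M\<in>Poly_Mapping.keys d. of_int (Poly_Mapping.lookup d M) * F M)"
  have fK: "f \<in> K i" for i unfolding f_def using F by (intro K_sum K_closed(7) K_of_int) auto
  have coeff: "(of_int c * Ymon M :: lmon \<Rightarrow>\<^sub>0 int) = Poly_Mapping.single M c" for c M
    by (induction c rule: int_induct[of _ 0])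
       (simp_all add: algebra_simps Ymon_def flip: single_add single_diff)
  have "f - d = (\<Sum>M\<in>Poly_Mapping.keys d. of_int (Poly_Mapping.lookup d M) * (F M - Ymon M))"
    by (simp add: f_def right_diff_distrib sum_subtractf coeff flip: sum_singles)
  then have low: "wt N < int n" if N: "N \<in> Poly_Mapping.keys (f - d)" for N
  proof -
    obtain M where M: "M \<in> Poly_Mapping.keys d"
      "N \<in> Poly_Mapping.keys (of_int (Poly_Mapping.lookup d M) * (F M - Ymon M))"
      using N \<open>f - d = _\<close> keys_sum by fastforce
    then have "N \<in> Poly_Mapping.keys (F M - Ymon M)"
      by (auto simp: in_keys_iff lookup_of_int_mult)
    then have "wt N < wt M" using F(2)[OF M(1)] by (simp add: lead_def)
    then show ?thesis using Suc.prems M(1) by fastforce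
  qed
  have supp: "Poly_Mapping.keys N \<subseteq> V" if "N \<in> Poly_Mapping.keys (f - d)" for N
    using that K_support[OF fK] Suc.prems keys_diff[of f d] by blast
  \<comment> \<open>The dominant part of the error \<open>f - d\<close>.\<close>
  define d' where "d' = (\<Sum>N\<in>{N\<in>Poly_Mapping.keys (f - d). dominant N}.
      Poly_Mapping.single N (Poly_Mapping.lookup (f - d) N))"
  have lk: "Poly_Mapping.lookup d' N = (if dominant N then Poly_Mapping.lookup (f - d) N else 0)" for N
    by (auto simp: d'_def lookup_sum lookup_single when_def in_keys_iff)
  have "\<forall>M\<in>Poly_Mapping.keys d'. dominant M \<and> Poly_Mapping.keys M \<subseteq> V \<and> wt M < int n"
  proof
    fix M assume "M \<in> Poly_Mapping.keys d'"
    then have "dominant M" "M \<in> Poly_Mapping.keys (f - d)"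
      by (simp_all add: in_keys_iff lk split: if_splits)
    then show "dominant M \<and> Poly_Mapping.keys M \<subseteq> V \<and> wt M < int n" using low supp by blast
  qed
  then obtain F' where F': "\<And>i. F' \<in> K i" "\<forall>M\<in>Poly_Mapping.keys (F' - d'). \<not> dominant M"
    using Suc.IH by blast
  \<comment> \<open>At dominant monomials \<open>F'\<close> agrees with \<open>d'\<close>, which
    agrees with \<open>f - d\<close>; so \<open>f - F'\<close> agrees with \<open>d\<close>
    there.\<close>
  have "\<not> dominant M" if M: "M \<in> Poly_Mapping.keys (f - F' - d)" for M
  proof
    assume "dominant M"
    then have "Poly_Mapping.lookup (F' - d') M = 0" using F'(2) by (meson in_keys_iff)
    then show False using M lk[of M] \<open>dominant M\<close> by (simp add: in_keys_iff lookup_minus)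
  qed
  then show ?case using fK F'(1) by (intro exI[of _ "f - F'"]) (auto intro: K_closed)
qed

lemma exists_with_dominant_part:
  assumes "\<forall>M\<in>Poly_Mapping.keys d. dominant M \<and> Poly_Mapping.keys M \<subseteq> V"
  shows "\<exists>F. (\<forall>i. F \<in> K i) \<and> (\<forall>M\<in>Poly_Mapping.keys (F - d). \<not> dominant M)"
proof (rule exists_with_dominant_part_bounded)
  \<comment> \<open>Inserting 0 covers an empty \<open>d\<close> and keeps \<open>?n\<close>
    nonnegative, so \<open>nat\<close> loses nothing; adding 1 makes the bound strict.\<close>
  let ?n = "Max (insert 0 (wt ` Poly_Mapping.keys d))"
  have "wt M \<le> ?n" if "M \<in> Poly_Mapping.keys d" for M using that by (intro Max_ge) auto
  then show "\<forall>M\<in>Poly_Mapping.keys d. dominant M \<and> Poly_Mapping.keys M \<subseteq> V \<and> wt M < int (nat (?n + 1))"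
    using assms by fastforce
qed

end

section \<open>Fundamental characters of type \<open>G\<^sub>2\<close>\<close>

definition weight :: "int \<Rightarrow> int \<Rightarrow> lmon \<Rightarrow> int" where
  "weight c d M = (\<Sum>v\<in>Poly_Mapping.keys M. (if fst v = N1 then c else d) * Poly_Mapping.lookup M v)"

lemma weight_superset:
  "finite S \<Longrightarrow> Poly_Mapping.keys M \<subseteq> S \<Longrightarrow>
    weight c d M = (\<Sum>v\<in>S. (if fst v = N1 then c else d) * Poly_Mapping.lookup M v)"
  unfolding weight_def by (rule sum.mono_neutral_left) (auto simp: in_keys_iff)

lemma weight_add: "weight c d (M + N) = weight c d M + weight c d N"
  using weight_superset[of "Poly_Mapping.keys M \<union> Poly_Mapping.keys N"] keys_add[of M N]
  by (simp add: lookup_add sum.distrib distrib_left)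

lemma weight_0: "weight c d 0 = 0"
  by (simp add: weight_def)

lemma weight_uminus: "weight c d (- M) = - weight c d M"
  using weight_add[of c d M "- M"] by (simp add: weight_0)

lemma weight_yvar: "weight c d (yvar i a) = (if i = N1 then c else d)"
  by (simp add: weight_def)

lemma weight_nonneg: "0 \<le> c \<Longrightarrow> 0 \<le> d \<Longrightarrow> dominant M \<Longrightarrow> 0 \<le> weight c d M"
  unfolding weight_def dominant_def by (intro sum_nonneg) auto

lemmas weight_simps = weight_add weight_0 weight_uminus weight_yvar

text \<open>Lets the leading monomial of an explicit sum be checked one summand at a time.\<close>

lemma (in sl2_pair) lead_add: "lead f M \<Longrightarrow> wt N < wt M \<Longrightarrow> lead (f + Ymon N) M"
  using keys_add[of "f - Ymon M" "Ymon N"]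
  by (auto simp: lead_def keys_Ymon algebra_simps)

section \<open>Variables and rank one data of type \<open>G_2\<close>\<close>

definition V_q :: "complex \<Rightarrow> (node \<times> complex) set" where
  "V_q q = UNIV \<times> powers q"

text \<open>For nonzero \<open>q\<close> these are the specializations at \<open>t = 1\<close> of
  \<open>yvar N1 a - Aexp q t N1 (a * q^3 * t)\<close> and
  \<open>yvar N2 a - Aexp q t N2 (a * q * t)\<close>.\<close>

fun B_q :: "complex \<Rightarrow> node \<times> complex \<Rightarrow> lmon" where
  "B_q q (N1, a) = yvar N2 (a * q) + yvar N2 (a * q^3) + yvar N2 (a * q^5) - yvar N1 (a * q^6)"
| "B_q q (N2, a) = yvar N1 (a * q) - yvar N2 (a * q^2)"

lemma powers_mult_power: "q \<noteq> 0 \<Longrightarrow> a \<in> powers q \<Longrightarrow> a * q ^ s \<in> powers q"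
  unfolding powers_def by clarify (metis power_int_add power_int_of_nat)

text \<open>
  The weights \<open>5\<close>, \<open>3\<close> (and \<open>3\<close>, \<open>5\<close> in the twisted case) are those for which both kinds of
  \<open>A\<^sub>i\<^sub>,\<^sub>a\<close> have weight \<open>1\<close>.
\<close>

lemma sl2_pair_q:
  assumes "q \<noteq> 0" shows "sl2_pair (V_q q) (weight 5 3) (B_q q)"
proof
  fix v assume v: "v \<in> V_q q"
  obtain i a where [simp]: "v = (i, a)" by fastforce
  have "(j, a * q ^ s) \<in> V_q q" for j s
    using v powers_mult_power[OF assms] by (auto simp: V_q_def)
  from this[of _ 1] this show "Poly_Mapping.keys (B_q q v) \<subseteq> V_q q"
    by (cases i) (fastforce simp: in_keys_iff lookup_add lookup_minus lookup_single when_def split: if_splits)+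
  show "weight 5 3 (B_q q v) < weight 5 3 (Poly_Mapping.single v 1)"
    by (cases i) (simp_all add: weight_simps diff_conv_add_uminus del: add_uminus_conv_diff)
qed (simp_all add: weight_simps weight_nonneg)

text \<open>Explicit q-characters are written down. Grouping the monomials into node 1 strings shows
  membership in \<open>K N1\<close>; regrouping the same monomials into node 2 strings shows
  membership in \<open>K N2\<close>.\<close>

lemma G2_fundamental:
  assumes q: "q \<noteq> 0" shows "sl2_pair_fundamental (V_q q) (weight 5 3) (B_q q)"
proof -
  interpret sl2_pair "V_q q" "weight 5 3" "B_q q" by (rule sl2_pair_q[OF q])
  show ?thesis
  proof
    fix v assume "v \<in> V_q q"
    then obtain i a where v: "v = (i, a)" and a: "a \<in> powers q" by (auto simp: V_q_def)
    define y where "y s = yvar N1 (a * q ^ s)" for s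
    define z where "z s = yvar N2 (a * q ^ s)" for s
    have V: "(j, a * q ^ s) \<in> V_q q" for j s
      using a powers_mult_power[OF q] by (auto simp: V_q_def)
    define X1 where "X1 s = chi (N1, a * q ^ s)" for s
    define X2 where "X2 s = chi (N2, a * q ^ s)" for s
    have X1: "X1 s = Ymon (y s) + Ymon (z (s + 1) + z (s + 3) + z (s + 5) - y (s + 6))" for s
      by (simp add: X1_def chi_def y_def z_def power_add mult_ac)
    have X2: "X2 s = Ymon (z s) + Ymon (y (s + 1) - z (s + 2))" for s
      by (simp add: X2_def chi_def y_def z_def power_add mult_ac power2_eq_square)
    have K1: "X1 s \<in> K N1" "Ymon (z s) \<in> K N1" "Ymon (- z s) \<in> K N1" for s
      unfolding X1_def z_def by (simp_all add: K_chi K_Ymon V)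
    have K2: "X2 s \<in> K N2" "Ymon (y s) \<in> K N2" "Ymon (- y s) \<in> K N2" for s
      unfolding X2_def y_def by (simp_all add: K_chi K_Ymon V)
    have wt: "weight 5 3 (y s) = 5" "weight 5 3 (z s) = 3" for s
      by (simp_all add: y_def z_def weight_simps)
    have wt_diff: "weight c d (M - N) = weight c d M - weight c d N" for c d M N
      using weight_add[of c d M "- N"] by (simp add: weight_uminus)
    show "\<exists>f. (\<forall>i. f \<in> K i) \<and> lead f (Poly_Mapping.single v 1)"
    proof (cases i)
      case N2
      \<comment> \<open>The q-character of the 7-dimensional fundamental representation.\<close>
      define f :: "lmon \<Rightarrow>\<^sub>0 int" where "f = Ymon (z 0) + Ymon (y 1 - z 2) + Ymon (z 4 + z 6 - y 7) + Ymon (z 4 - z 8)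
        + Ymon (y 5 - z 6 - z 8) + Ymon (z 10 - y 11) + Ymon (- z 12)"
      have "f = Ymon (z 0) + Ymon (- z 2) * X1 1 + Ymon (z 4) * Ymon (- z 8) + Ymon (- z 6) * Ymon (- z 8) * X1 5
        + Ymon (- z 12)"
        by (simp add: f_def X1 Ymon_simps algebra_simps eval_nat_numeral)
      also have "\<dots> \<in> K N1"
        by (intro K_closed(5,7) K1)
      finally have f1: "f \<in> K N1" .
      \<comment> \<open>In \<open>X2 4 * X2 6\<close> the variable \<open>z 6\<close> cancels in the
        term \<open>Ymon (y 5)\<close>; removing this term leaves a three-term string.\<close>
      have "f = X2 0 + Ymon (- y 7) * (X2 4 * X2 6 - Ymon (y 5)) + Ymon (- y 11) * X2 10"
        by (simp add: f_def X2 Ymon_simps algebra_simps eval_nat_numeral)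
      also have "\<dots> \<in> K N2"
        by (intro K_closed(5-7) K2)
      finally have "f \<in> K i" for i using f1 by (cases i) auto
      moreover have "lead f (z 0)"
        unfolding f_def by (intro lead_add lead_Ymon) (simp_all add: weight_simps wt wt_diff)
      ultimately show ?thesis unfolding v N2 by (auto simp: z_def)
    next
      case N1
      \<comment> \<open>15 = 14 + 1: over the finite type quantum group this is the adjoint
        representation plus a trivial one.\<close>
      define f :: "lmon \<Rightarrow>\<^sub>0 int" where "f = Ymon (y 0) + Ymon (z 1 + z 3 + z 5 - y 6) + Ymon (z 1 + z 3 - z 7)
        + Ymon (z 1 - z 5 - z 7 + y 4) + Ymon (y 2 + y 4 - z 3 - z 5 - z 7) + Ymon (z 1 + z 9 - y 10)
        + Ymon (y 2 + z 9 - z 3 - y 10) + Ymon (y 4 - y 8) + Ymon (z 5 + z 7 + z 9 - y 8 - y 10)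
        + Ymon (z 1 - z 11) + Ymon (y 2 - z 3 - z 11) + Ymon (z 5 + z 7 - y 8 - z 11)
        + Ymon (z 5 - z 9 - z 11) + Ymon (y 6 - z 7 - z 9 - z 11) + Ymon (- y 12)"
      have "f = X1 0 + Ymon (z 1) * Ymon (z 3) * Ymon (- z 7) + Ymon (z 1) * Ymon (- z 5) * Ymon (- z 7) * X1 4
        + Ymon (- z 3) * Ymon (- z 5) * Ymon (- z 7) * X1 2 * X1 4 + Ymon (z 1) * Ymon (- z 11)
        + Ymon (- z 3) * Ymon (- z 11) * X1 2 + Ymon (z 5) * Ymon (- z 9) * Ymon (- z 11)
        + Ymon (- z 7) * Ymon (- z 9) * Ymon (- z 11) * X1 6"
        by (simp add: f_def X1 Ymon_simps algebra_simps eval_nat_numeral)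
      also have "\<dots> \<in> K N1"
        by (intro K_closed(5,7) K1)
      finally have f1: "f \<in> K N1" .
      \<comment> \<open>In each triple product four of the eight terms contain a cancelling pair of
        neighbours. The two subtracted products remove exactly these and leave a four-term
        string.\<close>
      have "f = Ymon (y 0) + Ymon (- y 6) * (X2 1 * X2 3 * X2 5 - Ymon (y 2) * X2 5 - Ymon (y 4) * X2 1)
        + Ymon (- y 10) * X2 1 * X2 9 + Ymon (y 4) * Ymon (- y 8)
        + Ymon (- y 8) * Ymon (- y 10) * (X2 5 * X2 7 * X2 9 - Ymon (y 6) * X2 9 - Ymon (y 8) * X2 5)
        + Ymon (- y 12)"
        by (simp add: f_def X2 Ymon_simps algebra_simps eval_nat_numeral)
      also have "\<dots> \<in> K N2"
        by (intro K_closed(5-7) K2)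
      finally have "f \<in> K i" for i using f1 by (cases i) auto
      moreover have "lead f (y 0)"
        unfolding f_def by (intro lead_add lead_Ymon) (simp_all add: weight_simps wt wt_diff)
      ultimately show ?thesis unfolding v N1 by (auto simp: y_def)
    qed
  qed
qed

section \<open>Fundamental characters of twisted type \<open>D\<^sub>4\<close>\<close>

lemma eps_pow_3: "eps ^ 3 = -1"
proof -
  have "eps ^ 3 = exp (of_nat 3 * (\<i> * complex_of_real pi / 3))"
    unfolding eps_def by (rule exp_of_nat_mult[symmetric])
  then show ?thesis by (simp add: exp_pi_i')
qed

lemma eps_nonzero: "eps \<noteq> 0"
  by (simp add: eps_def)

text \<open>\<open>eps\<close> is a root of x^3 + 1 = (x + 1)(x^2 - x + 1) and is not real, so the
  second factor vanishes.\<close>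

lemma eps_sq: "eps ^ 2 = eps - 1"
proof -
  have "Im eps = sin (pi / 3)" by (simp add: eps_def Im_exp)
  then have "Im eps \<noteq> 0" using sin_gt_zero[of "pi / 3"] by simp
  then have "eps + 1 \<noteq> 0" by (auto simp: complex_eq_iff)
  moreover have "(eps + 1) * (eps ^ 2 - eps + 1) = eps ^ 3 + 1"
    by (simp add: algebra_simps power2_eq_square power3_eq_cube)
  ultimately have "eps ^ 2 - eps + 1 = 0" using eps_pow_3 by simp
  then show ?thesis by (simp add: algebra_simps eq_neg_iff_add_eq_0)
qed

lemma eps_pow_4: "eps ^ 4 = - eps"
proof -
  have "eps ^ 4 = eps ^ 3 * eps" by (simp add: eval_nat_numeral)
  then show ?thesis by (simp add: eps_pow_3)
qed

text \<open>\<open>eps ^ 2 = eps - 1\<close> and \<open>eps ^ 4 = - eps\<close> are the two roots of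
  x^2 + x + 1.\<close>

lemma cube_roots: "{b'. b' ^ 3 = b ^ 3} = {b, b * eps ^ 2, b * eps ^ 4}"
proof -
  have "b' ^ 3 - b ^ 3 = (b' - b) * ((b' - b * (eps - 1)) * (b' + b * eps))" for b'
  proof -
    have "(b' - b * (eps - 1)) * (b' + b * eps) = b' ^ 2 + b * b' - b ^ 2 * (eps ^ 2 - eps)"
      by (simp add: algebra_simps power2_eq_square)
    also have "\<dots> = b' ^ 2 + b * b' + b ^ 2" by (simp add: eps_sq)
    finally show ?thesis
      by (simp only:) (simp add: algebra_simps power2_eq_square power3_eq_cube)
  qed
  then have "b' ^ 3 = b ^ 3 \<longleftrightarrow> b' = b \<or> b' = b * (eps - 1) \<or> b' = - (b * eps)" for b'
    by (metis eq_iff_diff_eq_0 eq_neg_iff_add_eq_0 mult_eq_0_iff)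
  then show ?thesis by (auto simp: eps_sq eps_pow_4)
qed

text \<open>For nonzero \<open>b\<close> the three roots are distinct: a coincidence would force
  \<open>eps\<close> to be 2, -1 or 1/2.\<close>

lemma sum_cube_roots:
  fixes f :: "complex \<Rightarrow> 'a::comm_monoid_add"
  assumes "b \<noteq> 0"
  shows "(\<Sum>b' | b' ^ 3 = b ^ 3. f b') = f b + f (b * eps ^ 2) + f (b * eps ^ 4)"
proof -
  have "eps ^ 2 \<noteq> 1" "eps ^ 4 \<noteq> 1" "eps ^ 2 \<noteq> eps ^ 4"
  proof -
    show "eps ^ 2 \<noteq> 1"
    proof
      assume "eps ^ 2 = 1"
      then have "eps = 2" by (simp add: eps_sq eq_diff_eq)
      then have "(2::complex) ^ 3 = -1" using eps_pow_3 by metis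
      then show False by simp
    qed
    show "eps ^ 4 \<noteq> 1"
    proof
      assume "eps ^ 4 = 1"
      then have "eps = -1" by (metis eps_pow_4 minus_minus)
      then have "(-1::complex) ^ 2 = -1 - 1" using eps_sq by metis
      then show False by simp
    qed
    show "eps ^ 2 \<noteq> eps ^ 4"
    proof
      assume "eps ^ 2 = eps ^ 4"
      then have "eps = 1 / 2" by (simp add: eps_sq eps_pow_4 field_simps)
      then have "(1 / 2 :: complex) ^ 3 = -1" using eps_pow_3 by metis
      then show False by (simp add: power3_eq_cube)
    qed
  qed
  then show ?thesis using assms by (simp add: cube_roots add.assoc)
qed

section \<open>Variables and rank one data of twisted type \<open>D_4\<close>\<close>

definition V_t :: "complex \<Rightarrow> (node \<times> complex) set" where
  "V_t t = {N1} \<times> qt_lattice eps t \<union> {N2} \<times> (\<lambda>a. a ^ 3) ` qt_lattice eps t"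

text \<open>
  With \<open>c = b\<^sup>3\<close>, the three \<open>Z\<^sub>1\<close>-factors of \<open>Z\<^sub>2\<^sub>,\<^sub>c A\<^sup>-\<^sup>1\<close> are indexed by the cube roots of \<open>c\<close>, hence the
  exponent depends only on \<open>c\<close>.
\<close>

fun B_t :: "complex \<Rightarrow> node \<times> complex \<Rightarrow> lmon" where
  "B_t t (N1, a) = yvar N2 ((a * t) ^ 3) - yvar N1 (a * t^2)"
| "B_t t (N2, c) = (\<Sum>b | b ^ 3 = c. yvar N1 (b * t)) - yvar N2 (c * t^6)"

lemma qt_lattice_eps_mult:
  assumes "t \<noteq> 0" "a \<in> qt_lattice eps t" shows "a * eps ^ k * t ^ s \<in> qt_lattice eps t"
proof -
  obtain l m where "a = eps powi l * t powi m" using assms(2) by (auto simp: qt_lattice_def)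
  then have "a * eps ^ k * t ^ s = eps powi (l + int k) * t powi (m + int s)"
    using assms(1) eps_nonzero by (simp add: power_int_add)
  then show ?thesis unfolding qt_lattice_def by blast
qed

lemma qt_lattice_eps_nonzero: "t \<noteq> 0 \<Longrightarrow> a \<in> qt_lattice eps t \<Longrightarrow> a \<noteq> 0"
  using eps_nonzero by (auto simp: qt_lattice_def)

lemma B_t_cube:
  "b \<noteq> 0 \<Longrightarrow> B_t t (N2, b ^ 3) = yvar N1 (b * t) + yvar N1 (b * eps ^ 2 * t) + yvar N1 (b * eps ^ 4 * t)
     - yvar N2 (b ^ 3 * t^6)"
  by (simp add: sum_cube_roots)

lemma sl2_pair_t:
  assumes t: "t \<noteq> 0" shows "sl2_pair (V_t t) (weight 3 5) (B_t t)"
proof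
  fix v assume v: "v \<in> V_t t"
  \<comment> \<open>\<open>a\<close> is the index itself at node 1, and a chosen cube root of it at
    node 2.\<close>
  then obtain i a where va: "v = (i, if i = N1 then a else a ^ 3)" and a: "a \<in> qt_lattice eps t"
    by (force simp: V_t_def)
  have a0: "a \<noteq> 0" using qt_lattice_eps_nonzero[OF t a] .
  have V: "(N1, a * eps ^ k * t ^ s) \<in> V_t t" "(N2, (a * eps ^ k * t ^ s) ^ 3) \<in> V_t t" for k s
    using qt_lattice_eps_mult[OF t a] by (auto simp: V_t_def)
  show "Poly_Mapping.keys (B_t t v) \<subseteq> V_t t"
  proof (cases i)
    case N1
    have "Poly_Mapping.keys (B_t t v) \<subseteq> {(N2, (a * t) ^ 3), (N1, a * t^2)}"
      unfolding va N1 using keys_diff[of "yvar N2 ((a * t) ^ 3)" "yvar N1 (a * t^2)"] by auto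
    then show ?thesis using V(1)[of 0 2] V(2)[of 0 1] by auto
  next
    case N2
    have "Poly_Mapping.keys (B_t t v) \<subseteq>
        {(N1, a * t), (N1, a * eps^2 * t), (N1, a * eps^4 * t), (N2, a ^ 3 * t^6)}"
      unfolding va N2 by (simp only: B_t_cube[OF a0] diff_conv_add_uminus node.distinct if_False)
        (intro order.trans[OF keys_add] Un_least; simp)
    moreover have "a ^ 3 * t ^ 6 = (a * t^2) ^ 3" by (simp add: power_mult_distrib flip: power_mult)
    ultimately show ?thesis using V(1)[of 0 1] V(1)[of 2 1] V(1)[of 4 1] V(2)[of 0 2] by auto
  qed
  show "weight 3 5 (B_t t v) < weight 3 5 (Poly_Mapping.single v 1)"
    unfolding va using B_t_cube[OF a0, of t]
    by (cases i) (simp_all add: weight_simps diff_conv_add_uminus del: add_uminus_conv_diff B_t.simps(2))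
qed (simp_all add: weight_simps weight_nonneg)

text \<open>The method of \<open>G2_fundamental\<close>, with q-characters of untwisted
  \<open>D_4\<close> as pattern. Multiplying the index by \<open>eps ^ 2\<close> permutes the outer
  nodes cyclically and fixes its cube, hence the central variable.\<close>

lemma D4_twisted_fundamental:
  assumes t: "t \<noteq> 0" shows "sl2_pair_fundamental (V_t t) (weight 3 5) (B_t t)"
proof -
  interpret sl2_pair "V_t t" "weight 3 5" "B_t t" by (rule sl2_pair_t[OF t])
  show ?thesis
  proof
    fix w assume "w \<in> V_t t"
    then obtain i a where w: "w = (i, if i = N1 then a else a ^ 3)" and a: "a \<in> qt_lattice eps t"
      by (force simp: V_t_def)
    have a0: "a \<noteq> 0" using qt_lattice_eps_nonzero[OF t a] .
    txt \<open>
      The three families \<open>y 0\<close>, \<open>y 1\<close>, \<open>y 2\<close> play the role of the outer nodes of the untwisted diagram \<open>D\<^sub>4\<close>.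
    \<close>
    define y where "y k s = yvar N1 (a * eps ^ (2 * k) * t ^ s)" for k s
    define z where "z s = yvar N2 (a ^ 3 * t ^ (3 * s))" for s
    have V: "(N1, a * eps ^ k * t ^ s) \<in> V_t t" "(N2, a ^ 3 * t ^ (3 * s)) \<in> V_t t" for k s
    proof -
      have "a ^ 3 * t ^ (3 * s) = (a * eps ^ 0 * t ^ s) ^ 3"
        by (simp add: power_mult_distrib mult.commute flip: power_mult)
      then show "(N1, a * eps ^ k * t ^ s) \<in> V_t t" "(N2, a ^ 3 * t ^ (3 * s)) \<in> V_t t"
        using qt_lattice_eps_mult[OF t a, of _ s] by (auto simp only: V_t_def intro: imageI)
    qed
    define X1 where "X1 k s = chi (N1, a * eps ^ (2 * k) * t ^ s)" for k s
    define X2 where "X2 s = chi (N2, a ^ 3 * t ^ (3 * s))" for s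
    have X1: "X1 k s = Ymon (y k s) + Ymon (z (s + 1) - y k (s + 2))" for k s
    proof -
      have "(eps ^ (2 * k)) ^ 3 = ((eps ^ 3) ^ 2) ^ k" by (simp only: power_mult[symmetric] mult_ac)
      then have "(eps ^ (2 * k)) ^ 3 = 1" by (simp add: eps_pow_3)
      then have "(a * eps ^ (2 * k) * t ^ s * t) ^ 3 = a ^ 3 * t ^ (3 * (s + 1))"
        by (simp add: power_mult_distrib power_add mult_ac flip: power_mult)
      then show ?thesis
        by (simp add: X1_def chi_def y_def z_def power_add mult_ac power2_eq_square)
    qed
    have X2: "X2 s = Ymon (z s) + Ymon (y 0 (s + 1) + y 1 (s + 1) + y 2 (s + 1) - z (s + 2))" for s
    proof -
      have "a ^ 3 * t ^ (3 * s) = (a * t ^ s) ^ 3"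
        by (simp add: power_mult_distrib mult.commute flip: power_mult)
      moreover have "a ^ 3 * t ^ (3 * (s + 2)) = (a * t ^ s) ^ 3 * t ^ 6"
        by (simp add: power_mult_distrib power_add mult.commute flip: power_mult)
      ultimately show ?thesis
        using B_t_cube[of "a * t ^ s" t] a0 t
        by (simp add: X2_def chi_def y_def z_def mult_ac del: B_t.simps)
    qed
    have K1: "X1 k s \<in> K N1" "Ymon (z s) \<in> K N1" "Ymon (- z s) \<in> K N1" for k s
      unfolding X1_def z_def by (simp_all add: K_chi K_Ymon V)
    have K2: "X2 s \<in> K N2" "Ymon (y k s) \<in> K N2" "Ymon (- y k s) \<in> K N2" for k s
      unfolding X2_def y_def by (simp_all add: K_chi K_Ymon V)
    have wt: "weight 3 5 (y k s) = 3" "weight 3 5 (z s) = 5" for k s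
      by (simp_all add: y_def z_def weight_simps)
    have wt_diff: "weight c d (M - N) = weight c d M - weight c d N" for c d M N
      using weight_add[of c d M "- N"] by (simp add: weight_uminus)
    define u v w' where "u = y 0" and "v = y 1" and "w' = y 2"
    note uvw = u_def v_def w'_def
    show "\<exists>f. (\<forall>i. f \<in> K i) \<and> lead f (Poly_Mapping.single w 1)"
    proof (cases i)
      case N1
      \<comment> \<open>The pattern of the 8-dimensional representation of \<open>D_4\<close>
        attached to the outer node \<open>u\<close>.\<close>
      define f :: "lmon \<Rightarrow>\<^sub>0 int" where "f = Ymon (u 0) + Ymon (z 1 - u 2) + Ymon (v 2 + w' 2 - z 3)
        + Ymon (w' 2 - v 4) + Ymon (v 2 - w' 4) + Ymon (z 3 - v 4 - w' 4) + Ymon (u 4 - z 5) + Ymon (- u 6)"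
      have "f = X1 0 0 + Ymon (- z 3) * X1 1 2 * X1 2 2 + Ymon (- z 5) * X1 0 4"
        by (simp add: f_def X1 uvw Ymon_simps algebra_simps eval_nat_numeral)
      also have "\<dots> \<in> K N1"
        by (intro K_closed(5,7) K1)
      finally have f1: "f \<in> K N1" .
      have "f = Ymon (u 0) + Ymon (- u 2) * X2 1 + Ymon (w' 2) * Ymon (- v 4) + Ymon (v 2) * Ymon (- w' 4)
        + Ymon (- v 4) * Ymon (- w' 4) * X2 3 + Ymon (- u 6)"
        by (simp add: f_def X2 uvw Ymon_simps algebra_simps eval_nat_numeral)
      also have "\<dots> \<in> K N2"
        unfolding uvw by (intro K_closed(5,7) K2)
      finally have "f \<in> K i" for i using f1 by (cases i) auto
      moreover have "lead f (u 0)"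
        unfolding f_def uvw by (intro lead_add lead_Ymon) (simp_all add: weight_simps wt wt_diff)
      ultimately show ?thesis unfolding w N1 by (auto simp: u_def y_def)
    next
      case N2
      \<comment> \<open>29 = 28 + 1, the adjoint representation of \<open>D_4\<close> plus a trivial
        one; \<open>z 2 - z 4\<close> is listed twice.\<close>
      define f :: "lmon \<Rightarrow>\<^sub>0 int" where "f = Ymon (z 0) + Ymon (u 1 + v 1 + w' 1 - z 2)
        + Ymon (v 1 + w' 1 - u 3) + Ymon (u 1 + w' 1 - v 3) + Ymon (u 1 + v 1 - w' 3)
        + Ymon (w' 1 + z 2 - u 3 - v 3) + Ymon (v 1 + z 2 - u 3 - w' 3) + Ymon (u 1 + z 2 - v 3 - w' 3)
        + Ymon (z 2 + z 2 - u 3 - v 3 - w' 3) + Ymon (z 2 - z 4) + Ymon (z 2 - z 4)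
        + Ymon (u 1 + u 3 - z 4) + Ymon (v 1 + v 3 - z 4) + Ymon (w' 1 + w' 3 - z 4)
        + Ymon (u 1 - u 5) + Ymon (v 1 - v 5) + Ymon (w' 1 - w' 5)
        + Ymon (z 2 - u 3 - u 5) + Ymon (z 2 - v 3 - v 5) + Ymon (z 2 - w' 3 - w' 5)
        + Ymon (u 3 + v 3 + w' 3 - z 4 - z 4)
        + Ymon (v 3 + w' 3 - u 5 - z 4) + Ymon (u 3 + w' 3 - v 5 - z 4) + Ymon (u 3 + v 3 - w' 5 - z 4)
        + Ymon (w' 3 - u 5 - v 5) + Ymon (v 3 - u 5 - w' 5) + Ymon (u 3 - v 5 - w' 5)
        + Ymon (z 4 - u 5 - v 5 - w' 5) + Ymon (- z 6)"
      \<comment> \<open>Each product \<open>X1 k 1 * X1 k 3\<close> contains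
        \<open>Ymon (z 2)\<close>; of the three copies one is subtracted, which leaves the required
        two.\<close>
      have "f = Ymon (z 0) + Ymon (- z 2) * X1 0 1 * X1 1 1 * X1 2 1
        + Ymon (- z 4) * (X1 0 1 * X1 0 3 + X1 1 1 * X1 1 3 + X1 2 1 * X1 2 3 - Ymon (z 2))
        + Ymon (- z 4) * Ymon (- z 4) * X1 0 3 * X1 1 3 * X1 2 3 + Ymon (- z 6)"
        by (simp add: f_def X1 uvw Ymon_simps algebra_simps eval_nat_numeral)
      also have "\<dots> \<in> K N1"
        by (intro K_closed(5-7) K1)
      finally have f1: "f \<in> K N1" .
      \<comment> \<open>The doubled monomial \<open>z 2 - z 4\<close> is the cross term of the
        square of \<open>X2 2\<close>.\<close>
      have "f = X2 0
        + Ymon (v 1) * Ymon (w' 1) * Ymon (- u 3) + Ymon (u 1) * Ymon (w' 1) * Ymon (- v 3)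
        + Ymon (u 1) * Ymon (v 1) * Ymon (- w' 3)
        + (Ymon (w' 1) * Ymon (- u 3) * Ymon (- v 3) + Ymon (v 1) * Ymon (- u 3) * Ymon (- w' 3)
            + Ymon (u 1) * Ymon (- v 3) * Ymon (- w' 3)) * X2 2
        + Ymon (- u 3) * Ymon (- v 3) * Ymon (- w' 3) * X2 2 * X2 2
        + Ymon (u 1) * Ymon (- u 5) + Ymon (v 1) * Ymon (- v 5) + Ymon (w' 1) * Ymon (- w' 5)
        + (Ymon (- u 3) * Ymon (- u 5) + Ymon (- v 3) * Ymon (- v 5) + Ymon (- w' 3) * Ymon (- w' 5)) * X2 2
        + Ymon (w' 3) * Ymon (- u 5) * Ymon (- v 5) + Ymon (v 3) * Ymon (- u 5) * Ymon (- w' 5)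
        + Ymon (u 3) * Ymon (- v 5) * Ymon (- w' 5)
        + Ymon (- u 5) * Ymon (- v 5) * Ymon (- w' 5) * X2 4"
        by (simp add: f_def X2 uvw Ymon_simps algebra_simps eval_nat_numeral)
      also have "\<dots> \<in> K N2"
        unfolding uvw by (intro K_closed(5,7) K2)
      finally have "f \<in> K i" for i using f1 by (cases i) auto
      moreover have "lead f (z 0)"
        unfolding f_def uvw by (intro lead_add lead_Ymon) (simp_all add: weight_simps wt wt_diff)
      ultimately show ?thesis unfolding w N2 by (auto simp: z_def)
    qed
  qed
qed

section \<open>The quotient ring as a product\<close>

context
  fixes q t :: complex
  assumes nz: "q \<noteq> 0" "t \<noteq> 0"
    and nru: "\<forall>n>0. q ^ n \<noteq> 1" "\<forall>n>0. t ^ n \<noteq> 1" "powers q \<inter> powers t = {1}"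
begin

lemmas hom_q = hom_q_rules[OF nz nru]
lemmas hom_t = hom_t_rules[OF nz nru]

lemma hom_0: "hom_q q t 0 = 0" "hom_t q t 0 = 0"
  using hom_q(3)[of 0] hom_t(3)[of 0] by (simp_all add: subst_hom_def)

lemma hom_diff: "hom_q q t (f - g) = hom_q q t f - hom_q q t g" "hom_t q t (f - g) = hom_t q t f - hom_t q t g"
  using hom_q(1)[of f "- g"] hom_t(1)[of f "- g"] by (simp_all add: hom_q(3) hom_t(3))

abbreviation R where "R \<equiv> Y_qt q t"

definition cl :: "(lmon \<Rightarrow>\<^sub>0 int poly) \<Rightarrow> (lmon \<Rightarrow>\<^sub>0 int poly) set" where
  "cl g = a_r_coset R (ker_both q t) g"

lemmas R_closed = Y_closed(6-10)[OF nz nru]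

lemma R_diff: "f \<in> carrier R \<Longrightarrow> g \<in> carrier R \<Longrightarrow> f - g \<in> carrier R"
  unfolding Y_qt_def by (fact gen_closed)

lemma ker_both_iff:
  "h \<in> ker_both q t \<longleftrightarrow> h \<in> carrier R \<and> hom_q q t h = 0 \<and> hom_t q t h = 0"
  using Pi_eq[OF nz nru, of h] by (auto simp: ker_both_def a_kernel_def' Y_q_def Y_tL_def)

lemma cl_eq: "cl g = {h + g | h. h \<in> ker_both q t}"
  by (auto simp: cl_def a_r_coset_def' Y_qt_def)

text \<open>The descended maps pick the element of a one-point image, so what matters is that both
  specializations are constant on a class.\<close>

lemma Pi_tilde_cl:
  assumes "g \<in> carrier R"
  shows "Pi_q_tilde q t (cl g) = hom_q q t g" "Pi_t_tilde q t (cl g) = hom_t q t g"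
proof -
  have "Pi_q q t (h + g) = hom_q q t g \<and> Pi_t q t (h + g) = hom_t q t g" if "h \<in> ker_both q t" for h
    using that assms Pi_eq[OF nz nru, of "h + g"] by (simp add: ker_both_iff hom_q hom_t R_closed)
  moreover have "0 \<in> ker_both q t" by (simp add: ker_both_iff hom_0 R_closed)
  ultimately have "Pi_q q t ` cl g = {hom_q q t g}" "Pi_t q t ` cl g = {hom_t q t g}"
    unfolding cl_eq by force+
  then show "Pi_q_tilde q t (cl g) = hom_q q t g" "Pi_t_tilde q t (cl g) = hom_t q t g"
    by (simp_all add: Pi_q_tilde_def Pi_t_tilde_def)
qed

text \<open>The quotient divides out exactly the common kernel, so two specializations determine a
  class.\<close>

lemma cl_cong:
  assumes "g \<in> carrier R" "g' \<in> carrier R" "hom_q q t g = hom_q q t g'" "hom_t q t g = hom_t q t g'"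
  shows "cl g = cl g'"
proof -
  have "\<exists>h'. h + g = h' + g' \<and> h' \<in> ker_both q t" if "h \<in> ker_both q t" "g \<in> carrier R" "g' \<in> carrier R"
    "hom_q q t g = hom_q q t g'" "hom_t q t g = hom_t q t g'" for h g g'
    using that by (intro exI[of _ "h + (g - g')"]) (auto simp: ker_both_iff R_closed R_diff hom_q hom_t hom_diff)
  then show ?thesis
    using assms unfolding cl_eq by (intro Collect_eqI) metis
qed

lemma cl_ring_hom: "cl \<in> ring_hom R (Y_tilde q t)"
  unfolding cl_def Y_tilde_def by (rule ideal.rcos_ring_hom[OF ideal_ker_both[OF nz nru]])

lemma carrier_Y_tilde: "carrier (Y_tilde q t) = cl ` carrier R"
  by (auto simp: Y_tilde_def FactRing_def A_RCOSETS_def' cl_def)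

lemma cl_hom:
  "\<one>\<^bsub>Y_tilde q t\<^esub> = cl 1"
  "g \<in> carrier R \<Longrightarrow> g' \<in> carrier R \<Longrightarrow> cl g \<otimes>\<^bsub>Y_tilde q t\<^esub> cl g' = cl (g * g')"
  "g \<in> carrier R \<Longrightarrow> g' \<in> carrier R \<Longrightarrow> cl g \<oplus>\<^bsub>Y_tilde q t\<^esub> cl g' = cl (g + g')"
  using ring_hom_one[OF cl_ring_hom] ring_hom_mult[OF cl_ring_hom] ring_hom_add[OF cl_ring_hom]
  by (simp_all add: Y_qt_def)

lemma cl_uminus:
  assumes "g \<in> carrier R" shows "\<ominus>\<^bsub>Y_tilde q t\<^esub> cl g = cl (- g)"
proof -
  interpret R: cring R by (simp add: Y_qt_def cring_gen_subring)
  interpret Q: ring "Y_tilde q t"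
    unfolding Y_tilde_def by (rule ideal.quotient_is_ring[OF ideal_ker_both[OF nz nru]])
  have "\<zero>\<^bsub>Y_tilde q t\<^esub> = cl 0"
    using ring_hom_zero[OF cl_ring_hom R.ring_axioms Q.ring_axioms]
    by (simp add: Y_qt_def)
  then have "cl (- g) \<oplus>\<^bsub>Y_tilde q t\<^esub> cl g = \<zero>\<^bsub>Y_tilde q t\<^esub>"
    using assms by (simp add: cl_hom R_closed)
  then show ?thesis
    by (rule Q.minus_equality) (use assms in \<open>auto simp: carrier_Y_tilde R_closed\<close>)
qed

text \<open>Both specializations send \<open>beta\<close> to an idempotent, so reading modulo
  \<open>beta^2 - beta\<close> does not change the images.\<close>

lemma hom_dvd:
  assumes "(beta^2 - beta) dvd (g - f)"
  shows "hom_q q t g = hom_q q t f" "hom_t q t g = hom_t q t f"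
proof -
  obtain h where h: "g = (beta * beta - beta) * h + f"
    using assms by (auto simp: dvd_def power2_eq_square algebra_simps)
  show "hom_q q t g = hom_q q t f" "hom_t q t g = hom_t q t f"
    unfolding h hom_q(1,2) hom_t(1,2) hom_diff by (simp_all add: hom_q(6) hom_t(6))
qed

lemma denotedE:
  assumes "U \<in> denoted q t S"
  obtains g f where "g \<in> carrier R" "f \<in> S" "U = cl g" "hom_q q t g = hom_q q t f" "hom_t q t g = hom_t q t f"
  using assms hom_dvd unfolding denoted_def cl_def by blast

section \<open>Splitting a generated subring by the idempotent \<open>beta\<close>\<close>

context
  fixes G :: "(lmon \<Rightarrow>\<^sub>0 int poly) set" and GQ GT :: "(lmon \<Rightarrow>\<^sub>0 int) set"
  assumes G_denotable: "f \<in> G \<Longrightarrow> denoted q t {f} \<noteq> {}"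
    and beta_G: "beta \<in> G"
    and hom_G: "f \<in> G \<Longrightarrow> hom_q q t f \<in> carrier (gen_subring GQ)"
      "f \<in> G \<Longrightarrow> hom_t q t f \<in> carrier (gen_subring GT)"
    and G_surj: "y \<in> GQ \<Longrightarrow> \<exists>f\<in>G. hom_q q t f = y" "y \<in> GT \<Longrightarrow> \<exists>f\<in>G. hom_t q t f = y"
begin

lemma generate_denotedD:
  assumes "U \<in> generate_ring (Y_tilde q t) (denoted q t G)"
  shows "\<exists>g\<in>carrier R. U = cl g \<and> hom_q q t g \<in> carrier (gen_subring GQ) \<and> hom_t q t g \<in> carrier (gen_subring GT)"
  using assms
proof (induction rule: generate_ring.induct)
  case one
  then show ?case
    by (intro bexI[of _ 1]) (auto simp: cl_hom hom_q hom_t gen_closed R_closed)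
next
  case (incl U)
  then obtain g f where "g \<in> carrier R" "f \<in> G" "U = cl g" "hom_q q t g = hom_q q t f" "hom_t q t g = hom_t q t f"
    by (rule denotedE)
  then show ?case using hom_G[of f] by (intro bexI[of _ g]) simp_all
next
  case (a_inv U)
  then obtain g where "g \<in> carrier R" "U = cl g"
    "hom_q q t g \<in> carrier (gen_subring GQ)" "hom_t q t g \<in> carrier (gen_subring GT)" by blast
  then show ?case
    by (intro bexI[of _ "- g"]) (auto simp: cl_uminus hom_q hom_t gen_closed R_closed)
next
  case (eng_add U U')
  then obtain g g' where "g \<in> carrier R" "U = cl g"
    "hom_q q t g \<in> carrier (gen_subring GQ)" "hom_t q t g \<in> carrier (gen_subring GT)"
    "g' \<in> carrier R" "U' = cl g'"
    "hom_q q t g' \<in> carrier (gen_subring GQ)" "hom_t q t g' \<in> carrier (gen_subring GT)" by blast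
  then show ?case
    by (intro bexI[of _ "g + g'"]) (auto simp: cl_hom hom_q hom_t gen_closed R_closed)
next
  case (eng_mult U U')
  then obtain g g' where "g \<in> carrier R" "U = cl g"
    "hom_q q t g \<in> carrier (gen_subring GQ)" "hom_t q t g \<in> carrier (gen_subring GT)"
    "g' \<in> carrier R" "U' = cl g'"
    "hom_q q t g' \<in> carrier (gen_subring GQ)" "hom_t q t g' \<in> carrier (gen_subring GT)" by blast
  then show ?case
    by (intro bexI[of _ "g * g'"]) (auto simp: cl_hom hom_q hom_t gen_closed R_closed)
qed

text \<open>The preimage of the generated subring, which allows lifts to be computed with Laurent
  polynomials instead of classes.\<close>

definition L :: "(lmon \<Rightarrow>\<^sub>0 int poly) set" where
  "L = {g \<in> carrier R. cl g \<in> generate_ring (Y_tilde q t) (denoted q t G)}"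

lemma L_closed:
  "1 \<in> L" "g \<in> L \<Longrightarrow> - g \<in> L" "g \<in> L \<Longrightarrow> g' \<in> L \<Longrightarrow> g + g' \<in> L" "g \<in> L \<Longrightarrow> g' \<in> L \<Longrightarrow> g * g' \<in> L"
  "g \<in> L \<Longrightarrow> g' \<in> L \<Longrightarrow> g - g' \<in> L"
proof -
  note gi = generate_ring.intros[where R = "Y_tilde q t" and H = "denoted q t G"]
  show "1 \<in> L" using gi(1) by (simp add: L_def cl_hom R_closed)
  show m: "g \<in> L \<Longrightarrow> - g \<in> L" for g using gi(3)[of "cl g"] by (simp add: L_def cl_uminus R_closed)
  show a: "g \<in> L \<Longrightarrow> g' \<in> L \<Longrightarrow> g + g' \<in> L" for g g'
    using gi(4)[of "cl g" "cl g'"] by (simp add: L_def cl_hom R_closed)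
  show "g \<in> L \<Longrightarrow> g' \<in> L \<Longrightarrow> g * g' \<in> L"
    using gi(5)[of "cl g" "cl g'"] by (simp add: L_def cl_hom R_closed)
  show "g \<in> L \<Longrightarrow> g' \<in> L \<Longrightarrow> g - g' \<in> L" using a[OF _ m, of g g'] by simp
qed

lemma G_lift:
  assumes "f \<in> G" shows "\<exists>g\<in>L. hom_q q t g = hom_q q t f \<and> hom_t q t g = hom_t q t f"
proof -
  obtain U where "U \<in> denoted q t {f}" using G_denotable[OF assms] by blast
  moreover have "denoted q t {f} \<subseteq> denoted q t G" using assms by (auto simp: denoted_def)
  ultimately have U: "U \<in> denoted q t {f}" "U \<in> generate_ring (Y_tilde q t) (denoted q t G)"
    by (auto intro: generate_ring.incl)
  from U(1) obtain g f' where "g \<in> carrier R" "f' \<in> {f}" "U = cl g"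
    "hom_q q t g = hom_q q t f'" "hom_t q t g = hom_t q t f'"
    by (rule denotedE)
  then show ?thesis using U(2) by (intro bexI[of _ g]) (simp_all add: L_def)
qed

lemma beta_lift: "\<exists>b\<in>L. hom_q q t b = 1 \<and> hom_t q t b = 0"
  using G_lift[OF beta_G] by (simp add: hom_q hom_t)

text \<open>Multiplying by \<open>\<beta>\<close> and by \<open>1 - \<beta>\<close> lifts the two specializations independently of each other.\<close>

lemma lift_q:
  assumes "y \<in> carrier (gen_subring GQ)"
  shows "\<exists>g\<in>L. hom_q q t g = y \<and> hom_t q t g = 0"
  using assms
proof (induction rule: gen_induct)
  \<comment> \<open>The lift must vanish under the other specialization, so 1 is lifted to
    \<open>beta\<close> rather than to 1.\<close>
  case one then show ?case by (rule beta_lift)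
next
  case (incl y)
  obtain b where b: "b \<in> L" "hom_q q t b = 1" "hom_t q t b = 0" using beta_lift by blast
  obtain g where "g \<in> L" "hom_q q t g = y" using G_surj(1)[OF incl] G_lift by metis
  then show ?case using b by (intro bexI[of _ "b * g"]) (auto simp: hom_q hom_t L_closed)
next
  case (minus y)
  then show ?case by (auto intro!: bexI[OF _ L_closed(2)] simp: hom_q hom_t)
next
  case (add y z)
  then obtain g h where "g \<in> L" "h \<in> L" "hom_q q t g = y" "hom_q q t h = z" "hom_t q t g = 0" "hom_t q t h = 0"
    by blast
  then show ?case by (intro bexI[of _ "g + h"]) (simp_all add: hom_q hom_t L_closed)
next
  case (mult y z)
  then obtain g h where "g \<in> L" "h \<in> L" "hom_q q t g = y" "hom_q q t h = z" "hom_t q t g = 0" "hom_t q t h = 0"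
    by blast
  then show ?case by (intro bexI[of _ "g * h"]) (simp_all add: hom_q hom_t L_closed)
qed

lemma lift_t:
  assumes "y \<in> carrier (gen_subring GT)"
  shows "\<exists>g\<in>L. hom_q q t g = 0 \<and> hom_t q t g = y"
  using assms
proof (induction rule: gen_induct)
  case one
  obtain b where "b \<in> L" "hom_q q t b = 1" "hom_t q t b = 0" using beta_lift by blast
  then show ?case by (intro bexI[of _ "1 - b"]) (auto simp: hom_q hom_t hom_diff L_closed)
next
  case (incl y)
  obtain b where b: "b \<in> L" "hom_q q t b = 1" "hom_t q t b = 0" using beta_lift by blast
  obtain g where "g \<in> L" "hom_t q t g = y" using G_surj(2)[OF incl] G_lift by metis
  then show ?case using b by (intro bexI[of _ "(1 - b) * g"]) (auto simp: hom_q hom_t hom_diff L_closed)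
next
  case (minus y)
  then show ?case by (auto intro!: bexI[OF _ L_closed(2)] simp: hom_q hom_t)
next
  case (add y z)
  then obtain g h where "g \<in> L" "h \<in> L" "hom_q q t g = 0" "hom_q q t h = 0" "hom_t q t g = y" "hom_t q t h = z"
    by blast
  then show ?case by (intro bexI[of _ "g + h"]) (simp_all add: hom_q hom_t L_closed)
next
  case (mult y z)
  then obtain g h where "g \<in> L" "h \<in> L" "hom_q q t g = 0" "hom_q q t h = 0" "hom_t q t g = y" "hom_t q t h = z"
    by blast
  then show ?case by (intro bexI[of _ "g * h"]) (simp_all add: hom_q hom_t L_closed)
qed

text \<open>For the converse, the two images of \<open>g\<close> are lifted separately, each by an
  element vanishing on the other side; the sum of the lifts has the class of
  \<open>g\<close>.\<close>

lemma generate_denoted_iff: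
  assumes "g \<in> carrier R"
  shows "cl g \<in> generate_ring (Y_tilde q t) (denoted q t G) \<longleftrightarrow>
    hom_q q t g \<in> carrier (gen_subring GQ) \<and> hom_t q t g \<in> carrier (gen_subring GT)"
proof
  assume "cl g \<in> generate_ring (Y_tilde q t) (denoted q t G)"
  then obtain g' where g': "g' \<in> carrier R" "cl g = cl g'"
    "hom_q q t g' \<in> carrier (gen_subring GQ)" "hom_t q t g' \<in> carrier (gen_subring GT)"
    using generate_denotedD by blast
  then show "hom_q q t g \<in> carrier (gen_subring GQ) \<and> hom_t q t g \<in> carrier (gen_subring GT)"
    using Pi_tilde_cl[OF assms] Pi_tilde_cl[OF g'(1)] by simp
next
  assume h: "hom_q q t g \<in> carrier (gen_subring GQ) \<and> hom_t q t g \<in> carrier (gen_subring GT)"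
  obtain g1 g2 where g: "g1 \<in> L" "hom_q q t g1 = hom_q q t g" "hom_t q t g1 = 0"
    "g2 \<in> L" "hom_q q t g2 = 0" "hom_t q t g2 = hom_t q t g"
    using lift_q[of "hom_q q t g"] lift_t[of "hom_t q t g"] h by blast
  then have "g1 + g2 \<in> L" by (simp add: L_closed)
  moreover from this have "cl g = cl (g1 + g2)"
    using assms g by (intro cl_cong) (auto simp: L_def hom_q hom_t)
  ultimately show "cl g \<in> generate_ring (Y_tilde q t) (denoted q t G)" by (simp add: L_def)
qed

lemma exists_lift:
  assumes "y \<in> carrier (gen_subring GQ)" "z \<in> carrier (gen_subring GT)"
  shows "\<exists>g\<in>carrier R. hom_q q t g = y \<and> hom_t q t g = z"
proof -
  obtain g1 g2 where "g1 \<in> L" "hom_q q t g1 = y" "hom_t q t g1 = 0"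
    "g2 \<in> L" "hom_q q t g2 = 0" "hom_t q t g2 = z"
    using lift_q[OF assms(1)] lift_t[OF assms(2)] by blast
  then show ?thesis
    by (intro bexI[of _ "g1 + g2"]) (auto simp: L_def hom_q hom_t R_closed)
qed

end

end

section \<open>Specializations of the generators\<close>

context
  fixes q t :: complex
  assumes nz: "q \<noteq> 0" "t \<noteq> 0"
    and nru: "\<forall>n>0. q ^ n \<noteq> 1" "\<forall>n>0. t ^ n \<noteq> 1" "powers q \<inter> powers t = {1}"
begin

interpretation Q: sl2_pair_fundamental "V_q q" "weight 5 3" "B_q q"
  by (rule G2_fundamental[OF nz(1)])

interpretation T: sl2_pair_fundamental "V_t t" "weight 3 5" "B_t t"
  by (rule D4_twisted_fundamental[OF nz(2)])

lemmas hq = hom_q[OF nz nru]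
lemmas ht = hom_t[OF nz nru]
lemmas phi = phi_add[OF nz nru]

lemma phi_diff: "phi_q q t (M - N) = phi_q q t M - phi_q q t N" "phi_t q t (M - N) = phi_t q t M - phi_t q t N"
  using phi(2)[of M "- N"] phi(5)[of M "- N"] by (simp_all add: phi)

lemma lattice_shift:
  "q powi l * t powi m * (q ^ k * t ^ n) = q powi (l + int k) * t powi (m + int n)"
  using nz by (simp add: power_int_add)

lemma phi_q_shift:
  "phi_q q t (yvar i (q powi l * t powi m * (q ^ k * t ^ n))) = yvar i (q powi l * q ^ k)"
  unfolding lattice_shift phi_q_yvar[OF nz nru] using nz by (simp add: power_int_add)

lemma phi_t_shift:
  "phi_t q t (yvar N1 (q powi l * t powi m * (q ^ k * t ^ n))) = yvar N1 (eps powi l * t powi m * (eps ^ k * t ^ n))"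
  "phi_t q t (wvar q N2 (q powi l * t powi m * (q ^ k * t ^ n))) =
    yvar N2 (- ((eps powi l * t powi m * (eps ^ k * t ^ n)) ^ 3))"
proof -
  have e: "eps powi (l + int k) * t powi (m + int n) = eps powi l * t powi m * (eps ^ k * t ^ n)"
    using nz eps_nonzero by (simp add: power_int_add)
  show "phi_t q t (yvar N1 (q powi l * t powi m * (q ^ k * t ^ n))) = yvar N1 (eps powi l * t powi m * (eps ^ k * t ^ n))"
    using phi_t_wvar(1)[OF nz nru, of "l + int k" "m + int n"] unfolding lattice_shift e by simp
  show "phi_t q t (wvar q N2 (q powi l * t powi m * (q ^ k * t ^ n))) =
    yvar N2 (- ((eps powi l * t powi m * (eps ^ k * t ^ n)) ^ 3))"
    unfolding lattice_shift phi_t_wvar[OF nz nru] e ..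
qed

text \<open>Brings indices to the shape \<open>a * (q ^ k * t ^ n)\<close> on which the shift rules
  act. The string starts at exponent \<open>k\<close>, hence the centre
  \<open>k + 2\<close>.\<close>

lemma wvar_N2_shift:
  "wvar q N2 (a * (q ^ (k + 2) * t ^ n)) =
    yvar N2 (a * (q ^ k * t ^ n)) + yvar N2 (a * (q ^ (k + 2) * t ^ n)) + yvar N2 (a * (q ^ (k + 4) * t ^ n))"
  using nz by (simp add: power_add field_simps eval_nat_numeral)

lemma Aexp_N1_shift:
  "Aexp q t N1 (a * q ^ 3 * t) =
    yvar N1 (a * (q ^ 0 * t ^ 0)) + yvar N1 (a * (q ^ 6 * t ^ 2)) - wvar q N2 (a * (q ^ 3 * t ^ 1))"
  using nz by (simp add: field_simps eval_nat_numeral)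

lemma Aexp_N2_shift:
  "Aexp q t N2 (a * q ^ (k + 1) * t) =
    yvar N2 (a * (q ^ k * t ^ 0)) + yvar N2 (a * (q ^ (k + 2) * t ^ 2)) - yvar N1 (a * (q ^ (k + 1) * t ^ 1))"
  using nz by (simp add: field_simps eval_nat_numeral)

lemma phi_q_wvar_N2:
  "phi_q q t (wvar q N2 (q powi l * t powi m * (q ^ (k + 2) * t ^ n))) =
    yvar N2 (q powi l * q ^ k) + yvar N2 (q powi l * q ^ (k + 2)) + yvar N2 (q powi l * q ^ (k + 4))"
  unfolding wvar_N2_shift phi phi_q_shift ..

lemmas nat_numerals = one_plus_numeral numeral_plus_one one_add_one add_num_simps add_0 numeral_plus_numeral

lemma hom_K1_gen:
  fixes l m :: int
  defines "f \<equiv> Ymon (yvar N1 (q powi l * t powi m)) * (1 + Ymon (- Aexp q t N1 (q powi l * t powi m * q ^ 3 * t)))"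
  shows "hom_q q t f = Q.chi (N1, q powi l)" "hom_t q t f = T.chi (N1, eps powi l * t powi m)"
proof -
  have f: "f = Ymon (yvar N1 (q powi l * t powi m * (q ^ 0 * t ^ 0)))
      + Ymon (wvar q N2 (q powi l * t powi m * (q ^ 3 * t ^ 1)) - yvar N1 (q powi l * t powi m * (q ^ 6 * t ^ 2)))"
    unfolding f_def Aexp_N1_shift by (simp add: Ymon_simps algebra_simps del: wvar.simps)
  show "hom_q q t f = Q.chi (N1, q powi l)"
    unfolding f hq phi_diff phi_q_shift phi_q_wvar_N2[of l m 1 1, simplified nat_numerals]
    by (simp add: Q.chi_def)
  \<comment> \<open>The centre of the node 2 string is shifted by \<open>q ^ 3\<close>, which
    becomes -1; its cube cancels the sign in the image of \<open>wvar q N2\<close>.\<close>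
  have "- ((eps powi l * t powi m * (eps ^ 3 * t)) ^ 3) = (eps powi l * t powi m * t) ^ 3"
    by (simp add: eps_pow_3)
  moreover have "eps ^ 6 = 1" using power_mult[of eps 3 2] by (simp add: eps_pow_3)
  ultimately show "hom_t q t f = T.chi (N1, eps powi l * t powi m)"
    unfolding f ht phi_diff phi_t_shift by (simp add: T.chi_def)
qed

lemma hom_K2_gen_short:
  fixes l m :: int
  defines "f \<equiv> beta * Ymon (yvar N2 (q powi l * t powi m)) * (1 + Ymon (- Aexp q t N2 (q powi l * t powi m * q * t)))"
  shows "hom_q q t f = Q.chi (N2, q powi l)" "hom_t q t f = 0"
proof -
  have f: "f = beta * (Ymon (yvar N2 (q powi l * t powi m * (q ^ 0 * t ^ 0)))
      + Ymon (yvar N1 (q powi l * t powi m * (q ^ 1 * t ^ 1)) - yvar N2 (q powi l * t powi m * (q ^ 2 * t ^ 2))))"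
    unfolding f_def Aexp_N2_shift[of _ 0, simplified nat_numerals power_one_right]
    by (simp add: Ymon_simps algebra_simps)
  show "hom_q q t f = Q.chi (N2, q powi l)"
    unfolding f hq phi_diff phi_q_shift by (simp add: Q.chi_def)
  show "hom_t q t f = 0" unfolding f ht by simp
qed

text \<open>
  At \<open>\<beta> = 1\<close> the long generator is a Kirillov--Reshetikhin character of length 3, a polynomial in the
  short ones.
\<close>

lemma hom_K2_gen_long:
  fixes l m :: int
  defines "f \<equiv> Ymon (yvar N2 (q powi l * t powi m)) * Ymon (yvar N2 (q powi l * t powi m * q^2))
      * Ymon (yvar N2 (q powi l * t powi m * q^4)) *
        (1 + beta * Ymon (- Aexp q t N2 (q powi l * t powi m * q^5 * t))
           + beta * Ymon (- Aexp q t N2 (q powi l * t powi m * q^5 * t)) * Ymon (- Aexp q t N2 (q powi l * t powi m * q^3 * t))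
           + Ymon (- Aexp q t N2 (q powi l * t powi m * q^5 * t)) * Ymon (- Aexp q t N2 (q powi l * t powi m * q^3 * t))
             * Ymon (- Aexp q t N2 (q powi l * t powi m * q * t)))"
  shows "hom_q q t f \<in> Q.K N2" "hom_t q t f = T.chi (N2, (eps powi (l + 1) * t powi m) ^ 3)"
proof -
  define a where "a = q powi l * t powi m"
  define y where "y k = yvar N1 (q powi l * q ^ k)" for k
  define z where "z k = yvar N2 (q powi l * q ^ k)" for k
  define P where "P = yvar N2 (a * (q ^ 0 * t ^ 0)) + yvar N2 (a * (q ^ 2 * t ^ 0)) + yvar N2 (a * (q ^ 4 * t ^ 0))"
  define u where "u k = yvar N1 (a * (q ^ (k + 1) * t ^ 1)) - yvar N2 (a * (q ^ k * t ^ 0)) - yvar N2 (a * (q ^ (k + 2) * t ^ 2))" for k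
  have A: "- Aexp q t N2 (a * q ^ (k + 1) * t) = u k" for k
    unfolding Aexp_N2_shift u_def by simp
  have f: "f = Ymon P + beta * Ymon (P + u 4) + beta * Ymon (P + u 4 + u 2) + Ymon (P + u 4 + u 2 + u 0)"
    unfolding f_def a_def[symmetric] P_def A[of 4, simplified nat_numerals] A[of 2, simplified nat_numerals]
      A[of 0, simplified nat_numerals power_one_right]
    by (simp add: Ymon_simps algebra_simps)
  have pP: "phi_q q t P = z 0 + z 2 + z 4"
    unfolding P_def a_def phi phi_q_shift z_def ..
  have pu: "phi_q q t (u k) = y (k + 1) - z k - z (k + 2)" for k
    unfolding u_def a_def phi_diff phi_q_shift y_def z_def ..
  have V: "(i, q powi l * q ^ k) \<in> V_q q" for i k
    using powers_mult_power[OF nz(1), of "q powi l"] by (auto simp: V_q_def powers_def)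
  define c where "c k = Q.chi (N2, q powi l * q ^ k)" for k
  have c: "c k = Ymon (z k) + Ymon (y (k + 1) - z (k + 2))" for k
    by (simp add: c_def Q.chi_def y_def z_def power_add mult_ac power2_eq_square)
  \<comment> \<open>As in the triple products of \<open>G2_fundamental\<close>, the subtracted terms
    leave four of the eight.\<close>
  have "hom_q q t f = c 0 * c 2 * c 4 - Ymon (y 1) * c 4 - Ymon (y 3) * c 0"
    unfolding f hq phi pP pu c by (simp add: Ymon_simps algebra_simps eval_nat_numeral)
  also have "\<dots> \<in> Q.K N2"
    unfolding c_def y_def by (intro Q.K_closed(6,7) Q.K_chi Q.K_Ymon V) simp_all
  finally show "hom_q q t f \<in> Q.K N2" .
  \<comment> \<open>With x = \<open>eps powi l * t powi m\<close>, the leading string goes to the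
    index -(x eps^2)^3 = -x^3 = (x eps)^3, so \<open>b\<close> is x times
    \<open>eps\<close>.\<close>
  define b where "b = eps powi (l + 1) * t powi m"
  have b: "eps powi l * t powi m * eps = b"
    using eps_nonzero by (simp add: b_def power_int_add)
  have "phi_t q t P = yvar N2 (- ((eps powi l * t powi m * (eps ^ 2 * t ^ 0)) ^ 3))"
    unfolding a_def[symmetric] phi_t_shift(2)[of l m 2 0, folded a_def, symmetric]
    unfolding wvar_N2_shift[of a 0 0, simplified nat_numerals] P_def ..
  moreover have "- ((eps powi l * t powi m * eps ^ 2) ^ 3) = b ^ 3"
    using power_mult[of eps 3 2] by (simp add: eps_pow_3 power_mult_distrib flip: b power_mult)
  ultimately have tP: "phi_t q t P = yvar N2 (b ^ 3)"
    by simp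
  \<comment> \<open>The three node 1 indices specialize to \<open>b * t\<close>,
    \<open>b * eps ^ 2 * t\<close> and \<open>b * eps ^ 4 * t\<close>, the cube roots over which
    \<open>B_t\<close> sums.\<close>
  have "P + u 4 + u 2 + u 0 = yvar N1 (a * (q ^ 1 * t ^ 1)) + yvar N1 (a * (q ^ 3 * t ^ 1)) + yvar N1 (a * (q ^ 5 * t ^ 1))
      - wvar q N2 (a * (q ^ 4 * t ^ 2))"
    unfolding wvar_N2_shift[of a 2 2, simplified nat_numerals] P_def u_def nat_numerals
    by (simp add: algebra_simps)
  then have "phi_t q t (P + u 4 + u 2 + u 0) =
      yvar N1 (b * t) + yvar N1 (b * eps ^ 2 * t) + yvar N1 (b * eps ^ 4 * t) - yvar N2 (b ^ 3 * t ^ 6)"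
  proof -
    have "- ((eps powi l * t powi m * (eps ^ 4 * t ^ 2)) ^ 3) = b ^ 3 * t ^ 6"
      by (simp add: eps_pow_4 power_mult_distrib flip: b power_mult)
    note c = this
    have y: "eps powi l * t powi m * (eps ^ 1 * t ^ 1) = b * t"
      "eps powi l * t powi m * (eps ^ 3 * t ^ 1) = b * eps ^ 2 * t"
      "eps powi l * t powi m * (eps ^ 5 * t ^ 1) = b * eps ^ 4 * t"
      by (simp_all add: mult_ac eval_nat_numeral flip: b)
    show ?thesis
      unfolding \<open>P + u 4 + u 2 + u 0 = _\<close> a_def phi_diff phi phi_t_shift c y ..
  qed
  moreover have "b \<noteq> 0" using nz eps_nonzero by (simp add: b_def)
  ultimately show "hom_t q t f = T.chi (N2, (eps powi (l + 1) * t powi m) ^ 3)"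
    unfolding f ht tP b_def[symmetric] by (simp add: T.chi_def B_t_cube del: B_t.simps)
qed

lemma V_q_mem: "(i, q powi l) \<in> V_q q"
  by (auto simp: V_q_def powers_def)

lemma V_t_mem: "(N1, eps powi l * t powi m) \<in> V_t t" "(N2, (eps powi l * t powi m) ^ 3) \<in> V_t t"
  by (auto simp: V_t_def qt_lattice_def)

text \<open>\<open>eps ^ 3 = -1\<close> trades the sign for one more \<open>eps\<close> inside the
  cube.\<close>

lemma minus_cube: "- ((eps powi l * t powi m) ^ 3) = (eps powi (l + 1) * t powi m) ^ 3"
  using eps_nonzero by (simp add: power_int_add power_mult_distrib eps_pow_3)

lemma hom_Ymon_wvar:
  "hom_q q t (Ymon (wvar q N2 (q powi l * t powi m))) \<in> Q.K N1"
  "hom_q q t (Ymon (- wvar q N2 (q powi l * t powi m))) \<in> Q.K N1"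
  "hom_t q t (Ymon (wvar q N2 (q powi l * t powi m))) = Ymon (yvar N2 ((eps powi (l + 1) * t powi m) ^ 3))"
  "hom_t q t (Ymon (- wvar q N2 (q powi l * t powi m))) = Ymon (- yvar N2 ((eps powi (l + 1) * t powi m) ^ 3))"
proof -
  have a: "q powi l * t powi m = q powi (l - 2) * t powi m * (q ^ (0 + 2) * t ^ 0)"
    unfolding lattice_shift by simp
  have V: "q powi (l - 2) * q ^ k = q powi (l - 2 + int k)" for k
    using nz by (simp add: power_int_add)
  show "hom_q q t (Ymon (wvar q N2 (q powi l * t powi m))) \<in> Q.K N1"
    unfolding a hq phi_q_wvar_N2 V Ymon_simps(2)[symmetric]
    by (intro Q.K_closed(7) Q.K_Ymon V_q_mem) simp_all
  show "hom_q q t (Ymon (- wvar q N2 (q powi l * t powi m))) \<in> Q.K N1"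
    unfolding a hq phi phi_q_wvar_N2 V minus_add_distrib Ymon_simps(2)[symmetric]
    by (intro Q.K_closed(7) Q.K_Ymon V_q_mem) simp_all
  show "hom_t q t (Ymon (wvar q N2 (q powi l * t powi m))) = Ymon (yvar N2 ((eps powi (l + 1) * t powi m) ^ 3))"
    "hom_t q t (Ymon (- wvar q N2 (q powi l * t powi m))) = Ymon (- yvar N2 ((eps powi (l + 1) * t powi m) ^ 3))"
    unfolding ht phi phi_t_wvar[OF nz nru] minus_cube by (rule refl)+
qed

lemma hom_beta_Ymon:
  "hom_q q t (beta * Ymon (yvar i (q powi l * t powi m))) = Ymon (yvar i (q powi l))"
  "hom_q q t (beta * Ymon (- yvar i (q powi l * t powi m))) = Ymon (- yvar i (q powi l))"
  "hom_t q t (beta * f) = 0"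
  by (simp_all add: hq ht phi phi_q_yvar[OF nz nru])

lemma hom_Ymon_N1:
  "hom_q q t (Ymon (yvar N1 (q powi l * t powi m))) = Ymon (yvar N1 (q powi l))"
  "hom_q q t (Ymon (- yvar N1 (q powi l * t powi m))) = Ymon (- yvar N1 (q powi l))"
  "hom_t q t (Ymon (yvar N1 (q powi l * t powi m))) = Ymon (yvar N1 (eps powi l * t powi m))"
  "hom_t q t (Ymon (- yvar N1 (q powi l * t powi m))) = Ymon (- yvar N1 (eps powi l * t powi m))"
  using phi_t_wvar(1)[OF nz nru, of l m] by (simp_all add: hq ht phi phi_q_yvar[OF nz nru])

lemma hom_beta: "hom_q q t beta = 1" "hom_t q t beta = 0"
  by (simp_all add: hq ht)

section \<open>Matching the generators with those of the rank one subrings\<close>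

lemma hom_K1_gens:
  assumes "f \<in> K1_gens q t"
  shows "hom_q q t f \<in> Q.K N1" "hom_t q t f \<in> T.K N1"
proof -
  consider l m where "f = Ymon (yvar N1 (q powi l * t powi m)) * (1 + Ymon (- Aexp q t N1 (q powi l * t powi m * q ^ 3 * t)))"
    | l m where "f = Ymon (wvar q N2 (q powi l * t powi m))"
    | l m where "f = Ymon (- wvar q N2 (q powi l * t powi m))"
    | l m where "f = beta * Ymon (yvar N2 (q powi l * t powi m))"
    | l m where "f = beta * Ymon (- yvar N2 (q powi l * t powi m))"
    | "f = beta"
    using assms unfolding K1_gens_def qt_lattice_def by blast
  then have "hom_q q t f \<in> Q.K N1 \<and> hom_t q t f \<in> T.K N1"
  proof cases
    case 1
    show ?thesis unfolding 1 hom_K1_gen by (simp add: Q.K_chi T.K_chi V_q_mem V_t_mem)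
  next
    case 2
    show ?thesis unfolding 2 using hom_Ymon_wvar(1) by (simp only: hom_Ymon_wvar(3)) (simp add: T.K_Ymon V_t_mem)
  next
    case 3
    show ?thesis unfolding 3 using hom_Ymon_wvar(2) by (simp only: hom_Ymon_wvar(4)) (simp add: T.K_Ymon V_t_mem)
  next
    case 4
    show ?thesis unfolding 4 hom_beta_Ymon by (simp add: Q.K_Ymon T.K_closed V_q_mem)
  next
    case 5
    show ?thesis unfolding 5 hom_beta_Ymon by (simp add: Q.K_Ymon T.K_closed V_q_mem)
  next
    case 6
    show ?thesis unfolding 6 hom_beta by (simp add: Q.K_closed T.K_closed)
  qed
  then show "hom_q q t f \<in> Q.K N1" "hom_t q t f \<in> T.K N1" by blast+
qed

lemma hom_K2_gens:
  assumes "f \<in> K2_gens q t"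
  shows "hom_q q t f \<in> Q.K N2" "hom_t q t f \<in> T.K N2"
proof -
  consider l m where "f = Ymon (yvar N2 (q powi l * t powi m)) * Ymon (yvar N2 (q powi l * t powi m * q^2))
      * Ymon (yvar N2 (q powi l * t powi m * q^4)) *
        (1 + beta * Ymon (- Aexp q t N2 (q powi l * t powi m * q^5 * t))
           + beta * Ymon (- Aexp q t N2 (q powi l * t powi m * q^5 * t)) * Ymon (- Aexp q t N2 (q powi l * t powi m * q^3 * t))
           + Ymon (- Aexp q t N2 (q powi l * t powi m * q^5 * t)) * Ymon (- Aexp q t N2 (q powi l * t powi m * q^3 * t))
             * Ymon (- Aexp q t N2 (q powi l * t powi m * q * t)))"
    | l m where "f = beta * Ymon (yvar N2 (q powi l * t powi m)) * (1 + Ymon (- Aexp q t N2 (q powi l * t powi m * q * t)))"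
    | l m where "f = Ymon (yvar N1 (q powi l * t powi m))"
    | l m where "f = Ymon (- yvar N1 (q powi l * t powi m))"
    | "f = beta"
    using assms unfolding K2_gens_def qt_lattice_def by blast
  then have "hom_q q t f \<in> Q.K N2 \<and> hom_t q t f \<in> T.K N2"
  proof cases
    case (1 l m)
    show ?thesis unfolding 1 using hom_K2_gen_long(1)[of l m]
      by (simp only: hom_K2_gen_long(2)) (simp add: T.K_chi V_t_mem)
  next
    case 2
    show ?thesis unfolding 2 hom_K2_gen_short by (simp add: Q.K_chi T.K_closed V_q_mem)
  next
    case 3
    show ?thesis unfolding 3 hom_Ymon_N1 by (simp add: Q.K_Ymon T.K_Ymon V_q_mem V_t_mem)
  next
    case 4
    show ?thesis unfolding 4 hom_Ymon_N1 by (simp add: Q.K_Ymon T.K_Ymon V_q_mem V_t_mem)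
  next
    case 5
    show ?thesis unfolding 5 hom_beta by (simp add: Q.K_closed T.K_closed)
  qed
  then show "hom_q q t f \<in> Q.K N2" "hom_t q t f \<in> T.K N2" by blast+
qed

lemma qt_lattice_mem: "q powi l * t powi m \<in> qt_lattice q t"
  by (auto simp: qt_lattice_def)

lemma Q_gensE:
  assumes "y \<in> Q.gens i"
  obtains l where "y = Q.chi (i, q powi l)"
  | j l where "j \<noteq> i" "y = Ymon (yvar j (q powi l))"
  | j l where "j \<noteq> i" "y = Ymon (- yvar j (q powi l))"
proof -
  have v: "\<exists>l. v = (fst v, q powi l)" if "v \<in> V_q q" for v
    using that by (auto simp: V_q_def powers_def)
  consider v where "v \<in> V_q q" "fst v = i" "y = Q.chi v"
    | v where "v \<in> V_q q" "fst v \<noteq> i" "y = Ymon (Poly_Mapping.single v 1)"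
    | v where "v \<in> V_q q" "fst v \<noteq> i" "y = Ymon (- Poly_Mapping.single v 1)"
    using assms unfolding Q.gens_def by blast
  then show thesis using v that by cases metis+
qed

lemma T_gensE:
  assumes "y \<in> T.gens i"
  obtains l m where "i = N1" "y = T.chi (N1, eps powi l * t powi m)"
  | l m where "i = N2" "y = T.chi (N2, (eps powi (l + 1) * t powi m) ^ 3)"
  | l m where "i = N2" "y = Ymon (yvar N1 (eps powi l * t powi m))"
  | l m where "i = N2" "y = Ymon (- yvar N1 (eps powi l * t powi m))"
  | l m where "i = N1" "y = Ymon (yvar N2 ((eps powi (l + 1) * t powi m) ^ 3))"
  | l m where "i = N1" "y = Ymon (- yvar N2 ((eps powi (l + 1) * t powi m) ^ 3))"
proof -
  have "\<exists>l m. v = (N1, eps powi l * t powi m) \<or> v = (N2, (eps powi (l + 1) * t powi m) ^ 3)"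
    if v: "v \<in> V_t t" for v
  proof -
    \<comment> \<open>Writing the exponent as \<open>l - 1 + 1\<close> produces the shifted form in
      which node 2 indices arise from \<open>minus_cube\<close>.\<close>
    obtain l m where "v = (N1, eps powi l * t powi m) \<or> v = (N2, (eps powi (l - 1 + 1) * t powi m) ^ 3)"
      using v by (auto simp: V_t_def qt_lattice_def)
    then show ?thesis by (metis diff_add_cancel)
  qed
  note v = this
  consider v where "v \<in> V_t t" "fst v = i" "y = T.chi v"
    | v where "v \<in> V_t t" "fst v \<noteq> i" "y = Ymon (Poly_Mapping.single v 1)"
    | v where "v \<in> V_t t" "fst v \<noteq> i" "y = Ymon (- Poly_Mapping.single v 1)"
    using assms unfolding T.gens_def by blast
  then show thesis
  proof cases
    case 1
    then show ?thesis using v[of v] that(1,2) by auto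
  next
    case 2
    then show ?thesis using v[of v] that(3,5) by (cases i) auto
  next
    case 3
    then show ?thesis using v[of v] that(4,6) by (cases i) auto
  qed
qed

lemma K1_gens_mem:
  assumes "a \<in> qt_lattice q t"
  shows "Ymon (yvar N1 a) * (1 + Ymon (- Aexp q t N1 (a * q ^ 3 * t))) \<in> K1_gens q t"
    "Ymon (wvar q N2 a) \<in> K1_gens q t" "Ymon (- wvar q N2 a) \<in> K1_gens q t"
    "beta * Ymon (yvar N2 a) \<in> K1_gens q t" "beta * Ymon (- yvar N2 a) \<in> K1_gens q t"
  unfolding K1_gens_def using assms by blast+

lemma K2_gens_mem:
  assumes "a \<in> qt_lattice q t"
  shows "Ymon (yvar N2 a) * Ymon (yvar N2 (a * q^2)) * Ymon (yvar N2 (a * q^4)) *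
        (1 + beta * Ymon (- Aexp q t N2 (a * q^5 * t))
           + beta * Ymon (- Aexp q t N2 (a * q^5 * t)) * Ymon (- Aexp q t N2 (a * q^3 * t))
           + Ymon (- Aexp q t N2 (a * q^5 * t)) * Ymon (- Aexp q t N2 (a * q^3 * t))
             * Ymon (- Aexp q t N2 (a * q * t))) \<in> K2_gens q t"
    "beta * Ymon (yvar N2 a) * (1 + Ymon (- Aexp q t N2 (a * q * t))) \<in> K2_gens q t"
    "Ymon (yvar N1 a) \<in> K2_gens q t" "Ymon (- yvar N1 a) \<in> K2_gens q t"
  unfolding K2_gens_def using assms by blast+

lemma node_neq: "j \<noteq> N1 \<longleftrightarrow> j = N2" "j \<noteq> N2 \<longleftrightarrow> j = N1"
  by (cases j; simp)+

text \<open>The node 2 units have different sources: \<open>beta * Ymon (yvar N2 a)\<close> and its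
  inverse variant on the \<open>q\<close> side, \<open>wvar q N2 a\<close> on the \<open>t\<close>
  side.\<close>

lemma K1_gens_surj:
  "y \<in> Q.gens N1 \<Longrightarrow> \<exists>f\<in>K1_gens q t. hom_q q t f = y"
  "y \<in> T.gens N1 \<Longrightarrow> \<exists>f\<in>K1_gens q t. hom_t q t f = y"
proof -
  note mem = K1_gens_mem[OF qt_lattice_mem]
  show "\<exists>f\<in>K1_gens q t. hom_q q t f = y" if "y \<in> Q.gens N1"
    using that
  proof (cases rule: Q_gensE)
    case (1 l)
    show ?thesis unfolding 1 using hom_K1_gen(1) mem(1) by blast
  next
    case (2 j l)
    then show ?thesis unfolding node_neq using hom_beta_Ymon(1) mem(4) by blast
  next
    case (3 j l)
    then show ?thesis unfolding node_neq using hom_beta_Ymon(2) mem(5) by blast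
  qed
  show "\<exists>f\<in>K1_gens q t. hom_t q t f = y" if "y \<in> T.gens N1"
    using that
  proof (cases rule: T_gensE)
    case (1 l m)
    show ?thesis unfolding 1(2) using hom_K1_gen(2) mem(1) by blast
  next
    case (5 l m)
    show ?thesis unfolding 5(2) using hom_Ymon_wvar(3) mem(2) by blast
  next
    case (6 l m)
    show ?thesis unfolding 6(2) using hom_Ymon_wvar(4) mem(3) by blast
  qed simp_all
qed

text \<open>The node 2 characters come from the short generators on the \<open>q\<close> side and
  from the long ones on the \<open>t\<close> side.\<close>

lemma K2_gens_surj:
  "y \<in> Q.gens N2 \<Longrightarrow> \<exists>f\<in>K2_gens q t. hom_q q t f = y"
  "y \<in> T.gens N2 \<Longrightarrow> \<exists>f\<in>K2_gens q t. hom_t q t f = y"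
proof -
  note mem = K2_gens_mem[OF qt_lattice_mem]
  show "\<exists>f\<in>K2_gens q t. hom_q q t f = y" if "y \<in> Q.gens N2"
    using that
  proof (cases rule: Q_gensE)
    case (1 l)
    show ?thesis unfolding 1 using hom_K2_gen_short(1) mem(2) by blast
  next
    case (2 j l)
    then show ?thesis unfolding node_neq using hom_Ymon_N1(1) mem(3) by blast
  next
    case (3 j l)
    then show ?thesis unfolding node_neq using hom_Ymon_N1(2) mem(4) by blast
  qed
  show "\<exists>f\<in>K2_gens q t. hom_t q t f = y" if "y \<in> T.gens N2"
    using that
  proof (cases rule: T_gensE)
    case (2 l m)
    show ?thesis unfolding 2(2) using hom_K2_gen_long(2) mem(1) by blast
  next
    case (3 l m)
    show ?thesis unfolding 3(2) using hom_Ymon_N1(3) mem(3) by blast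
  next
    case (4 l m)
    show ?thesis unfolding 4(2) using hom_Ymon_N1(4) mem(4) by blast
  qed simp_all
qed

lemma beta_gens: "beta \<in> K1_gens q t" "beta \<in> K2_gens q t"
  by (simp_all add: K1_gens_def K2_gens_def)

lemma gens_denotable:
  "f \<in> K1_gens q t \<Longrightarrow> denoted q t {f} \<noteq> {}" "f \<in> K2_gens q t \<Longrightarrow> denoted q t {f} \<noteq> {}"
  by (rule K_gens_denotable[OF nz nru]; simp)+

lemmas K1_glue = gens_denotable(1) beta_gens(1) hom_K1_gens[unfolded Q.K_def T.K_def] K1_gens_surj
lemmas K2_glue = gens_denotable(2) beta_gens(2) hom_K2_gens[unfolded Q.K_def T.K_def] K2_gens_surj

lemma K_iff:
  assumes "g \<in> carrier (Y_qt q t)"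
  shows "cl q t g \<in> K1 q t \<longleftrightarrow> hom_q q t g \<in> Q.K N1 \<and> hom_t q t g \<in> T.K N1"
    "cl q t g \<in> K2 q t \<longleftrightarrow> hom_q q t g \<in> Q.K N2 \<and> hom_t q t g \<in> T.K N2"
proof -
  show "cl q t g \<in> K1 q t \<longleftrightarrow> hom_q q t g \<in> Q.K N1 \<and> hom_t q t g \<in> T.K N1"
    unfolding K1_def Q.K_def T.K_def
    by (rule generate_denoted_iff[OF nz nru K1_glue assms])
  show "cl q t g \<in> K2 q t \<longleftrightarrow> hom_q q t g \<in> Q.K N2 \<and> hom_t q t g \<in> T.K N2"
    unfolding K2_def Q.K_def T.K_def
    by (rule generate_denoted_iff[OF nz nru K2_glue assms])
qed

text \<open>Lifting through \<open>K1\<close> is enough to obtain a representative; membership of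
  its class in \<open>K2\<close> is then read off from its images by \<open>K_iff\<close>.\<close>

lemma exists_lift_K:
  assumes "y \<in> Q.K N1" "z \<in> T.K N1"
  shows "\<exists>g\<in>carrier (Y_qt q t). hom_q q t g = y \<and> hom_t q t g = z"
  by (rule exists_lift[OF nz nru K1_glue assms[unfolded Q.K_def T.K_def]])

lemma Kfrak_iff:
  assumes "g \<in> carrier (Y_qt q t)"
  shows "cl q t g \<in> Kfrak q t \<longleftrightarrow> (\<forall>i. hom_q q t g \<in> Q.K i) \<and> (\<forall>i. hom_t q t g \<in> T.K i)"
proof -
  have "(\<forall>i. P i) \<longleftrightarrow> P N1 \<and> P N2" for P
    using node.exhaust by metis
  then show ?thesis unfolding Kfrak_def Int_iff K_iff[OF assms] by auto
qed

lemma Kfrak_subset: "Kfrak q t \<subseteq> cl q t ` carrier (Y_qt q t)"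
proof
  fix U assume "U \<in> Kfrak q t"
  then have U: "U \<in> generate_ring (Y_tilde q t) (denoted q t (K1_gens q t))"
    by (simp add: Kfrak_def K1_def)
  have "\<exists>g\<in>carrier (Y_qt q t). U = cl q t g \<and> hom_q q t g \<in> carrier (gen_subring (Q.gens N1))
      \<and> hom_t q t g \<in> carrier (gen_subring (T.gens N1))"
    by (rule generate_denotedD[OF nz nru K1_glue U])
  then obtain g where "g \<in> carrier (Y_qt q t)" "U = cl q t g" by (elim bexE conjE)
  then show "U \<in> cl q t ` carrier (Y_qt q t)" by blast
qed

text \<open>Both exponent maps send a variable to a variable or to 0, so no negative exponent
  arises.\<close>

lemma phi_dominant:
  assumes "dominant M" shows "dominant (phi_q q t M)" "dominant (phi_t q t M)"
proof -
  have *: "dominant (frag_extend f M)" if "\<And>v. dominant (f v)" for f :: "node \<times> complex \<Rightarrow> lmon"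
    using assms that
    by (auto simp: dominant_def frag_extend_def lookup_sum intro!: sum_nonneg mult_nonneg_nonneg)
  show "dominant (phi_q q t M)" unfolding phi_q_def[OF nz nru]
    by (rule *) (auto simp: dominant_def lookup_single when_def)
  show "dominant (phi_t q t M)" unfolding phi_t_def[OF nz nru]
    by (rule *) (auto simp: dominant_def lookup_single when_def split: node.split)
qed

lemma keys_phi_q:
  assumes "Poly_Mapping.keys M \<subseteq> UNIV \<times> qt_lattice q t"
  shows "Poly_Mapping.keys (phi_q q t M) \<subseteq> V_q q"
  unfolding phi_q_def[OF nz nru]
  by (rule order.trans[OF keys_frag_extend]) (auto simp: V_q_def powers_def)

lemma keys_phi_t:
  "Poly_Mapping.keys (phi_t q t M) \<subseteq> V_t t"
  unfolding phi_t_def[OF nz nru] minus_cube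
proof (rule order.trans[OF keys_frag_extend], rule UN_least)
  fix v
  show "Poly_Mapping.keys (case v of (i, a) \<Rightarrow> (case i of
      N1 \<Rightarrow> yvar N1 (eps powi q_exp q t a * t powi t_exp q t a)
    | N2 \<Rightarrow> (if 3 dvd q_exp q t a then yvar N2 ((eps powi (q_exp q t a + 1) * t powi t_exp q t a)^3) else 0))) \<subseteq> V_t t"
    using V_t_mem by (cases v, cases "fst v") simp_all
qed

text \<open>The two specializations are solved separately and glued. The difference of two solutions
  has no dominant monomial in either specialization, hence vanishes in both.\<close>

lemma exists_unique_F:
  assumes "dominant_monomial q t m"
  shows "\<exists>!F. F \<in> Kfrak q t \<and> unique_dominant_monomial q t m F"
proof -
  obtain lam mu :: int and M where M: "Poly_Mapping.keys M \<subseteq> UNIV \<times> qt_lattice q t" "dominant M"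
    and m: "m \<in> denoted q t {(of_int lam + of_int mu * beta) * Ymon M}"
    using assms unfolding dominant_monomial_def by (elim exE conjE)
  from m obtain g f where g: "g \<in> carrier (Y_qt q t)" "f \<in> {(of_int lam + of_int mu * beta) * Ymon M}"
    "m = cl q t g" "hom_q q t g = hom_q q t f" "hom_t q t g = hom_t q t f"
    by (rule denotedE[OF nz nru])
  have int: "hom_q q t (of_int k) = of_int k" "hom_t q t (of_int k) = of_int k" for k :: int
    by (induction k rule: int_induct[of _ 0]) (simp_all add: hom_0[OF nz nru] hom_diff[OF nz nru] hq ht)
  have m_hom: "hom_q q t g = of_int (lam + mu) * Ymon (phi_q q t M)" "hom_t q t g = of_int lam * Ymon (phi_t q t M)"
    using g(2,4,5) by (simp_all add: hq ht int)
  \<comment> \<open>Only an inclusion: the coefficients \<open>lam + mu\<close> (at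
    \<open>beta = 1\<close>) and \<open>lam\<close> (at \<open>beta = 0\<close>) may be 0.\<close>
  have keys_scale: "Poly_Mapping.keys (of_int k * Ymon N :: lmon \<Rightarrow>\<^sub>0 int) \<subseteq> {N}" for k N
    by (auto simp: in_keys_iff lookup_of_int_mult Ymon_def lookup_single when_def split: if_splits)
  have tilde: "Pi_q_tilde q t (cl q t h) = hom_q q t h" "Pi_t_tilde q t (cl q t h) = hom_t q t h"
    if "h \<in> carrier (Y_qt q t)" for h
    using Pi_tilde_cl[OF nz nru that] by simp_all
  have "\<forall>N\<in>Poly_Mapping.keys (hom_q q t g). dominant N \<and> Poly_Mapping.keys N \<subseteq> V_q q"
    using subsetD[OF keys_scale] phi_dominant(1)[OF M(2)] keys_phi_q[OF M(1)] unfolding m_hom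
    by (metis singletonD)
  from Q.exists_with_dominant_part[OF this] obtain Fq where Fq: "\<And>i. Fq \<in> Q.K i"
    "\<forall>N\<in>Poly_Mapping.keys (Fq - hom_q q t g). \<not> dominant N" by blast
  have "\<forall>N\<in>Poly_Mapping.keys (hom_t q t g). dominant N \<and> Poly_Mapping.keys N \<subseteq> V_t t"
    using subsetD[OF keys_scale] phi_dominant(2)[OF M(2)] keys_phi_t unfolding m_hom
    by (metis singletonD)
  from T.exists_with_dominant_part[OF this] obtain Ft where Ft: "\<And>i. Ft \<in> T.K i"
    "\<forall>N\<in>Poly_Mapping.keys (Ft - hom_t q t g). \<not> dominant N" by blast
  obtain h where h: "h \<in> carrier (Y_qt q t)" "hom_q q t h = Fq" "hom_t q t h = Ft"
    using exists_lift_K[OF Fq(1) Ft(1)] by blast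
  show ?thesis
  proof (rule ex1I[of _ "cl q t h"])
    show "cl q t h \<in> Kfrak q t \<and> unique_dominant_monomial q t m (cl q t h)"
      using h Fq Ft by (simp add: Kfrak_iff unique_dominant_monomial_def g(3) tilde g(1))
  next
    fix F assume F: "F \<in> Kfrak q t \<and> unique_dominant_monomial q t m F"
    then obtain k where k: "k \<in> carrier (Y_qt q t)" "F = cl q t k" using Kfrak_subset by blast
    have kK: "hom_q q t k \<in> Q.K i" "hom_t q t k \<in> T.K i" for i
      using F Kfrak_iff[OF k(1)] k(2) by blast+
    have kd: "\<forall>N\<in>Poly_Mapping.keys (hom_q q t k - hom_q q t g). \<not> dominant N"
      "\<forall>N\<in>Poly_Mapping.keys (hom_t q t k - hom_t q t g). \<not> dominant N"
      using F by (simp_all add: unique_dominant_monomial_def g(1,3) k tilde)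
    have no_dom: "\<forall>N\<in>Poly_Mapping.keys (f - f'). \<not> dominant N"
      if "\<forall>N\<in>Poly_Mapping.keys (f - d). \<not> dominant N" "\<forall>N\<in>Poly_Mapping.keys (f' - d). \<not> dominant N"
      for f f' d :: "lmon \<Rightarrow>\<^sub>0 int"
      using that keys_diff[of "f - d" "f' - d"] by auto
    have "hom_q q t k - Fq = 0"
      by (rule Q.eq_0_if_no_dominant[OF Q.K_closed(6)[OF kK(1) Fq(1)] no_dom[OF kd(1) Fq(2)]])
    moreover have "hom_t q t k - Ft = 0"
      by (rule T.eq_0_if_no_dominant[OF T.K_closed(6)[OF kK(2) Ft(1)] no_dom[OF kd(2) Ft(2)]])
    ultimately show "F = cl q t h"
      unfolding k(2) using h k(1) by (intro cl_cong[OF nz nru]) simp_all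
  qed
qed

end

theorem theorem5p4:
  fixes q t :: complex and m :: "(lmon \<Rightarrow>\<^sub>0 int poly) set"
  assumes "q \<noteq> 0" and "t \<noteq> 0"
    and "\<forall>n>0. q ^ n \<noteq> 1" and "\<forall>n>0. t ^ n \<noteq> 1"
    and "powers q \<inter> powers t = {1}"
    and "m \<in> carrier (Y_tilde q t)" and "dominant_monomial q t m"
  shows "\<exists>!F. F \<in> Kfrak q t \<and> unique_dominant_monomial q t m F"
  using exists_unique_F[OF assms(1-5,7)] .

end
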